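(* Let $p$ be a prime, let $G$ be a finite $p$-solvable group, let $k$ be a field of characteristic $p$, and let $V$ be a finite-dimensional absolutely irreducible $kG$-module, with representation $\rho: G \to \mathrm{GL}(V)$. If $p$ does not divide $\dim_k V$, then $(G,V)$ is weakly adequate, i.e. $\mathrm{End}_k(V)$ is spanned (as a $k$-vector space) by the elements $\rho(g)$, $g \in G$, for which $\rho(g)$ is semisimple.
   Context: A finite group is $p$-solvable if every composition factor has order $p$ or order prime to $p$. For a representation $\rho: G \to \mathrm{GL}(V)$, the pair $(G,V)$ is called weakly adequate if $\mathrm{End}_k(V)$ is spanned by the set $\{\rho(g) : g \in G,\ \rho(g) \text{ semisimple}\}$. *)

theory Defs
  imports "HOL-Algebra.SimpleGroups" "HOL-Algebra.Algebraic_Closure_Type"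
          "Jordan_Normal_Form.Matrix"
begin

definition composition_series :: "('g, 'b) monoid_scheme \<Rightarrow> (nat \<Rightarrow> 'g set) \<Rightarrow> nat \<Rightarrow> bool" where
  "composition_series G H m \<longleftrightarrow>
     H 0 = {\<one>\<^bsub>G\<^esub>} \<and> H m = carrier G \<and>
     (\<forall>i<m. subgroup (H i) G \<and> subgroup (H (Suc i)) G \<and>
            H i \<lhd> (G\<lparr>carrier := H (Suc i)\<rparr>) \<and>
            simple_group ((G\<lparr>carrier := H (Suc i)\<rparr>) Mod (H i)))"

definition comp_factor_order :: "('g, 'b) monoid_scheme \<Rightarrow> (nat \<Rightarrow> 'g set) \<Rightarrow> nat \<Rightarrow> nat" where
  "comp_factor_order G H i = card (carrier ((G\<lparr>carrier := H (Suc i)\<rparr>) Mod (H i)))"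

definition p_solvable :: "('g, 'b) monoid_scheme \<Rightarrow> nat \<Rightarrow> bool" where
  "p_solvable G p \<longleftrightarrow>
     (\<forall>H m. composition_series G H m \<longrightarrow>
        (\<forall>i<m. comp_factor_order G H i = p \<or> coprime (comp_factor_order G H i) p))"

definition subspace_vec :: "nat \<Rightarrow> 'a::field vec set \<Rightarrow> bool" where
  "subspace_vec n W \<longleftrightarrow> W \<subseteq> carrier_vec n \<and> 0\<^sub>v n \<in> W \<and>
     (\<forall>v\<in>W. \<forall>w\<in>W. v + w \<in> W) \<and> (\<forall>c. \<forall>v\<in>W. c \<cdot>\<^sub>v v \<in> W)"

definition invariant_under :: "'a::field mat \<Rightarrow> 'a vec set \<Rightarrow> bool" where
  "invariant_under A W \<longleftrightarrow> (\<forall>w\<in>W. A *\<^sub>v w \<in> W)"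

definition semisimple_mat :: "nat \<Rightarrow> 'a::field mat \<Rightarrow> bool" where
  "semisimple_mat n A \<longleftrightarrow>
     (\<forall>W. subspace_vec n W \<and> invariant_under A W \<longrightarrow>
        (\<exists>U. subspace_vec n U \<and> invariant_under A U \<and> W \<inter> U = {0\<^sub>v n} \<and>
             (\<forall>v\<in>carrier_vec n. \<exists>w\<in>W. \<exists>u\<in>U. v = w + u)))"

definition is_rep :: "('g, 'b) monoid_scheme \<Rightarrow> nat \<Rightarrow> ('g \<Rightarrow> 'a::field mat) \<Rightarrow> bool" where
  "is_rep G n \<rho> \<longleftrightarrow> (\<forall>g\<in>carrier G. \<rho> g \<in> carrier_mat n n) \<and> \<rho> \<one>\<^bsub>G\<^esub> = 1\<^sub>m n \<and>
     (\<forall>g\<in>carrier G. \<forall>h\<in>carrier G. \<rho> (g \<otimes>\<^bsub>G\<^esub> h) = \<rho> g * \<rho> h)"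

definition irreducible_rep :: "('g, 'b) monoid_scheme \<Rightarrow> nat \<Rightarrow> ('g \<Rightarrow> 'a::field mat) \<Rightarrow> bool" where
  "irreducible_rep G n \<rho> \<longleftrightarrow> n > 0 \<and>
     (\<forall>W. subspace_vec n W \<and> (\<forall>g\<in>carrier G. invariant_under (\<rho> g) W) \<longrightarrow>
        W = {0\<^sub>v n} \<or> W = carrier_vec n)"

definition abs_irreducible_rep :: "('g, 'b) monoid_scheme \<Rightarrow> nat \<Rightarrow> ('g \<Rightarrow> 'a::field mat) \<Rightarrow> bool" where
  "abs_irreducible_rep G n \<rho> \<longleftrightarrow> irreducible_rep G n (\<lambda>g. map_mat to_ac (\<rho> g))"

definition weakly_adequate :: "('g, 'b) monoid_scheme \<Rightarrow> nat \<Rightarrow> ('g \<Rightarrow> 'a::field mat) \<Rightarrow> bool" where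
  "weakly_adequate G n \<rho> \<longleftrightarrow>
     (\<forall>M\<in>carrier_mat n n. \<exists>F c.
        finite F \<and> F \<subseteq> {\<rho> g | g. g \<in> carrier G \<and> semisimple_mat n (\<rho> g)} \<and>
        (\<forall>i<n. \<forall>j<n. M $$ (i, j) = (\<Sum>A\<in>F. c A * A $$ (i, j))))"

end

theory Submission
  imports Defs "HOL-Library.Function_Algebras" "HOL-Algebra.Multiplicative_Group"
    "Jordan_Normal_Form.Char_Poly"
begin

text \<open>Let \<open>A\<close> be the span of the \<open>\<rho> x\<close> with \<open>x\<close> of order prime to \<open>p\<close>; these are semisimple by Maschke's
  averaging. By Burnside's theorem over the algebraic closure, \<open>\<rho> G\<close> spans all matrices, so it suffices
  that \<open>\<rho> (x y) \<in> A\<close> for \<open>x\<close> of order prime to \<open>p\<close> and \<open>y\<close> in a normal subgroup \<open>N\<close>, which is proved by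
  induction on \<open>N\<close>. Since \<open>G\<close> is \<open>p\<close>-solvable, \<open>N \<noteq> 1\<close> has a smaller subgroup \<open>M\<close>, normal in \<open>G\<close>, such
  that either \<open>N / M\<close> has order prime to \<open>p\<close> or \<open>N / M\<close> is elementary abelian of exponent \<open>p\<close>. In the first
  case \<open>x y = x' w\<close> with \<open>x'\<close> of order prime to \<open>p\<close> and \<open>w \<in> M\<close>. In the second case \<open>\<rho> N\<close> and \<open>\<rho> M\<close>
  have the same span: by the double commutant theorem it is enough that they have the same commutant,
  and this holds because the trace form on the commutant of \<open>N\<close> is non-degenerate when \<open>p\<close> does not
  divide the dimension, while the \<open>p\<close>-group \<open>N / M\<close> acts unipotently on the commutant of \<open>M\<close>.\<close>

section \<open>Stable subspaces\<close>

text \<open>The terms of a composition series are subnormal but need not be normal in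
  \<open>G\<close>, whereas both Clifford's argument and the trace argument use conjugation by all
  of \<open>G\<close>. So the series only serves as a measuring rod: if \<open>N\<close> lies in
  \<open>H (Suc i)\<close> but not in \<open>H i\<close>, then \<open>M\<close> is generated by a
  conjugation-stable subset of \<open>N\<close> that lands in \<open>H i\<close>, namely its
  elements of \<open>p\<close>-power order, or its \<open>p\<close>-th powers and commutators. Such
  an \<open>M\<close> is normal in \<open>G\<close> and strictly smaller than \<open>N\<close>.

  Irreducibility is used only over the closure, to obtain the spanning property. That property
  descends to \<open>k\<close>, and from then on the matrix algebra replaces the representation
  space: subspaces stable under left multiplication play the role of submodules, and simplicity of
  the matrix algebra plays the role of irreducibility.\<close>

locale operator_space = vector_space scale
  for scale :: "'a::field \<Rightarrow> 'b::ab_group_add \<Rightarrow> 'b"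
begin

definition stable :: "('b \<Rightarrow> 'b) set \<Rightarrow> 'b set \<Rightarrow> bool" where
  "stable T W \<longleftrightarrow> subspace W \<and> (\<forall>t\<in>T. \<forall>w\<in>W. t w \<in> W)"

definition simple_stable :: "('b \<Rightarrow> 'b) set \<Rightarrow> 'b set \<Rightarrow> bool" where
  "simple_stable T S \<longleftrightarrow> stable T S \<and> (\<forall>A. stable T A \<and> A \<subseteq> S \<longrightarrow> A = {0} \<or> A = S)"

lemma stable_sums:
  assumes add: "\<And>t x y. t \<in> T \<Longrightarrow> t (x + y) = t x + t y"
    and A: "stable T A" and Y: "stable T Y"
  shows "stable T {x + y |x y. x \<in> A \<and> y \<in> Y}"
  unfolding stable_def
proof (intro conjI ballI)
  show "subspace {x + y |x y. x \<in> A \<and> y \<in> Y}"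
    using A Y by (intro subspace_sums) (auto simp: stable_def)
  fix t w assume t: "t \<in> T" and "w \<in> {x + y |x y. x \<in> A \<and> y \<in> Y}"
  then obtain x y where xy: "w = x + y" "x \<in> A" "y \<in> Y" by blast
  have "t w = t x + t y" "t x \<in> A" "t y \<in> Y"
    using add t A Y xy by (auto simp: stable_def)
  then show "t w \<in> {x + y |x y. x \<in> A \<and> y \<in> Y}" by blast
qed

text \<open>A stable \<open>U\<close> disjoint from \<open>A\<close> and maximal by Zorn absorbs
  every simple \<open>S\<close>: if \<open>S\<close> were not inside the sum of \<open>A\<close> and
  \<open>U\<close>, it would meet that sum only in 0, and adding \<open>S\<close> to
  \<open>U\<close> would give a larger choice.\<close>

lemma stable_complement:
  assumes add: "\<And>t x y. t \<in> T \<Longrightarrow> t (x + y) = t x + t y"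
    and simple: "\<And>S. S \<in> \<S> \<Longrightarrow> simple_stable T S"
    and A: "stable T A"
  shows "\<exists>U. stable T U \<and> A \<inter> U = {0} \<and> span (\<Union>\<S>) \<subseteq> {x + u |x u. x \<in> A \<and> u \<in> U}"
proof -
  let ?A = "{U. stable T U \<and> A \<inter> U = {0}}"
  have A0: "0 \<in> A" using A subspace_0 by (auto simp: stable_def)
  have t0: "t 0 = 0" if "t \<in> T" for t
    using add[OF that, of 0 0] by simp
  have ne: "?A \<noteq> {}"
  proof -
    have "{0} \<in> ?A" using A0 t0 by (auto simp: stable_def)
    then show ?thesis by blast
  qed
  have "\<exists>M\<in>?A. \<forall>Y\<in>?A. M \<subseteq> Y \<longrightarrow> Y = M"
  proof (rule subset_Zorn_nonempty[OF ne])
    fix C assume C: "C \<noteq> {}" "subset.chain ?A C"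
    then have CA: "C \<subseteq> ?A" and tot: "\<And>a b. a \<in> C \<Longrightarrow> b \<in> C \<Longrightarrow> a \<subseteq> b \<or> b \<subseteq> a"
      by (auto simp: subset.chain_def)
    have sub: "subspace U" if "U \<in> C" for U using CA that by (auto simp: stable_def)
    have "subspace (\<Union>C)"
      unfolding subspace_def
    proof (intro conjI ballI allI)
      show "0 \<in> \<Union>C" using C(1) sub subspace_0 by blast
      show "x + y \<in> \<Union>C" if xy: "x \<in> \<Union>C" "y \<in> \<Union>C" for x y
      proof -
        obtain a b where ab: "a \<in> C" "b \<in> C" "x \<in> a" "y \<in> b" using xy by blast
        then have "x \<in> (if a \<subseteq> b then b else a)" "y \<in> (if a \<subseteq> b then b else a)"
          using tot[of a b] by auto
        then show ?thesis
          using ab(1,2) sub subspace_add by (metis UnionI)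
      qed
      show "scale c x \<in> \<Union>C" if "x \<in> \<Union>C" for c x
        using that sub subspace_scale by (metis UnionE UnionI)
    qed
    moreover have "\<forall>t\<in>T. \<forall>w\<in>\<Union>C. t w \<in> \<Union>C"
      using CA by (fastforce simp: stable_def)
    moreover have "A \<inter> \<Union>C = {0}" using CA C(1) by blast
    ultimately show "\<Union>C \<in> ?A" by (auto simp: stable_def)
  qed
  then obtain U where UA: "U \<in> ?A" and max': "\<forall>Y\<in>?A. U \<subseteq> Y \<longrightarrow> Y = U"
    by (rule bexE)
  have U: "stable T U" "A \<inter> U = {0}" using UA by simp_all
  have max: "Y = U" if "stable T Y" "A \<inter> Y = {0}" "U \<subseteq> Y" for Y
    using bspec[OF max', of Y] that by simp
  define P where "P = {x + u |x u. x \<in> A \<and> u \<in> U}"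
  have P: "stable T P" unfolding P_def by (rule stable_sums[OF add A U(1)])
  have U0: "0 \<in> U" using U by blast
  have "S \<subseteq> P" if S: "S \<in> \<S>" for S
  proof (rule ccontr)
    assume nS: "\<not> S \<subseteq> P"
    have sS: "stable T S" using simple[OF S] by (simp add: simple_stable_def)
    have "stable T (S \<inter> P)"
      using sS P subspace_inter[of S P] unfolding stable_def by blast
    moreover have "S \<inter> P \<noteq> S" using nS by auto
    moreover have "S \<inter> P \<subseteq> S" by (rule Int_lower1)
    ultimately have SP: "S \<inter> P = {0}"
      using simple[OF S] unfolding simple_stable_def by blast
    define Y where "Y = {u + s |u s. u \<in> U \<and> s \<in> S}"
    have S0: "0 \<in> S" using sS subspace_0 by (auto simp: stable_def)
    have Y: "stable T Y" unfolding Y_def by (rule stable_sums[OF add U(1) sS])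
    have "x = 0" if x: "x \<in> A" "x \<in> Y" for x
    proof -
      obtain u s where us: "x = u + s" "u \<in> U" "s \<in> S" using x unfolding Y_def by blast
      have "s = x + (- u)" using us by simp
      moreover have "- u \<in> U" using U(1) us subspace_neg by (auto simp: stable_def)
      ultimately have "s \<in> P" unfolding P_def using x by blast
      then have "s \<in> S \<inter> P" using us by simp
      then have "s = 0" by (simp only: SP singleton_iff)
      then show ?thesis using us x U(2) by auto
    qed
    moreover have "0 \<in> Y" unfolding Y_def using U0 S0 by force
    ultimately have "A \<inter> Y = {0}" using A0 by blast
    moreover have "U \<subseteq> Y" unfolding Y_def using S0 by force
    ultimately have "Y = U" using max Y by blast
    moreover have "S \<subseteq> Y" unfolding Y_def using U0 by force
    ultimately have "S \<subseteq> U" by simp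
    moreover have "U \<subseteq> P" unfolding P_def using A0 by force
    ultimately show False using nS by blast
  qed
  then have "span (\<Union>\<S>) \<subseteq> P"
    using P by (intro span_minimal) (auto simp: stable_def)
  then show ?thesis using U unfolding P_def by blast
qed

lemma dim_subset_less:
  assumes "subspace A" "A \<subset> Y" "Y \<subseteq> span B" "finite B"
  shows "dim A < dim Y"
proof -
  obtain P where P: "P \<subseteq> A" "independent P" "A \<subseteq> span P"
    using maximal_independent_subset[of A] by blast
  obtain Q where Q: "P \<subseteq> Q" "Q \<subseteq> Y" "independent Q" "Y \<subseteq> span Q"
    using maximal_independent_subset_extend[of P Y] P assms(2) by blast
  have "finite Q" using independent_span_bound[OF assms(4) Q(3)] Q assms(3) by blast
  moreover have "P \<noteq> Q"
    using P(1) Q(4) assms(1,2) span_minimal by blast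
  ultimately have "card P < card Q" using Q(1) by (simp add: psubset_card_mono psubsetI)
  then show ?thesis
    using basis_card_eq_dim P Q by metis
qed

text \<open>A non-zero stable subspace of least dimension is simple; the finite spanning set
  \<open>B\<close> makes \<open>dim\<close> drop strictly on proper subspaces.\<close>

lemma exists_simple_stable:
  assumes "stable T W" "W \<noteq> {0}" "W \<subseteq> span B" "finite B"
  shows "\<exists>S. S \<subseteq> W \<and> S \<noteq> {0} \<and> simple_stable T S"
proof -
  let ?P = "\<lambda>S. stable T S \<and> S \<subseteq> W \<and> S \<noteq> {0}"
  obtain S where S: "?P S" and min: "\<And>A. ?P A \<Longrightarrow> dim S \<le> dim A"
    using ex_has_least_nat[of ?P W dim] assms by blast
  have *: "A = {0} \<or> A = S" if A: "stable T A" "A \<subseteq> S" for A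
  proof (rule ccontr)
    assume nA: "\<not> ?thesis"
    then have "dim A < dim S"
      using dim_subset_less[of A S B] A S assms(3,4) by (meson psubsetI stable_def subset_trans)
    moreover have "?P A" using A S nA by (meson subset_trans)
    ultimately show False using min[of A] by simp
  qed
  show ?thesis
    by (rule exI[of _ S]) (simp add: simple_stable_def S *)
qed

section \<open>Powers of one operator: binomial expansion in characteristic \<open>p\<close> and
  Maschke averaging\<close>

lemma funpow_eq_sum_binomial:
  assumes f: "Vector_Spaces.linear scale scale f"
  shows "(f ^^ k) v = (\<Sum>i\<le>k. scale (of_nat (k choose i)) (((\<lambda>x. f x - x) ^^ i) v))"
proof (induction k)
  case (Suc k)
  let ?T = "\<lambda>x. f x - x" and ?b = "\<lambda>k i. of_nat (k choose i)"
  interpret vector_space_pair scale scale ..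
  have T: "Vector_Spaces.linear scale scale ?T"
    using f by (simp add: Vector_Spaces.linear_iff vector_space_axioms algebra_simps)
  have "(f ^^ Suc k) v = (\<Sum>i\<le>k. scale (?b k i) ((?T ^^ i) v)) + ?T (\<Sum>i\<le>k. scale (?b k i) ((?T ^^ i) v))"
    using Suc by simp
  also have "?T (\<Sum>i\<le>k. scale (?b k i) ((?T ^^ i) v)) = (\<Sum>i\<le>k. scale (?b k i) ((?T ^^ Suc i) v))"
    by (simp add: linear_sum[OF T] linear_scale[OF T] del: funpow.simps)
       (simp add: linear_scale[OF f] scale_right_diff_distrib)
  also have "(\<Sum>i\<le>k. scale (?b k i) ((?T ^^ i) v)) =
      v + (\<Sum>i\<le>k. scale (?b k (Suc i)) ((?T ^^ Suc i) v))"
  proof -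
    have "(\<Sum>i\<le>k. scale (?b k i) ((?T ^^ i) v)) = (\<Sum>i\<le>Suc k. scale (?b k i) ((?T ^^ i) v))"
      by (simp add: binomial_eq_0)
    then show ?thesis by (simp only: sum.atMost_Suc_shift) simp
  qed
  also have "v + (\<Sum>i\<le>k. scale (?b k (Suc i)) ((?T ^^ Suc i) v)) + (\<Sum>i\<le>k. scale (?b k i) ((?T ^^ Suc i) v))
     = (\<Sum>i\<le>Suc k. scale (?b (Suc k) i) ((?T ^^ i) v))"
    by (simp only: sum.atMost_Suc_shift) (simp add: scale_left_distrib sum.distrib add.assoc add.commute add.left_commute)
  finally show ?case .
qed simp

text \<open>The inner binomial coefficients vanish in characteristic \<open>p\<close>. Expanding the
  power of \<open>f\<close>, written as 1 plus the difference operator, avoids all signs. The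
  outcome makes operators whose \<open>p\<close>-th power is 1 unipotent.\<close>

lemma funpow_char:
  assumes f: "Vector_Spaces.linear scale scale f" and p: "Factorial_Ring.prime p" "CHAR('a) = p"
  shows "((\<lambda>x. f x - x) ^^ p) v = (f ^^ p) v - v"
proof -
  let ?T = "\<lambda>x. f x - x"
  have "of_nat (p choose i) = (0 :: 'a)" if "0 < i" "i < p" for i
    using dvd_choose_prime[of i p] that p by (simp add: of_nat_eq_0_iff_char_dvd)
  then have "(\<Sum>i\<in>{..p} - {0, p}. scale (of_nat (p choose i)) ((?T ^^ i) v)) = 0"
    by (intro sum.neutral ballI) auto
  moreover have "(\<Sum>i\<le>p. scale (of_nat (p choose i)) ((?T ^^ i) v)) =
    (\<Sum>i\<in>{..p} - {0, p}. scale (of_nat (p choose i)) ((?T ^^ i) v)) +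
    (\<Sum>i\<in>{0, p}. scale (of_nat (p choose i)) ((?T ^^ i) v))"
    by (rule sum.subset_diff) auto
  moreover have "0 \<noteq> p" using p(1) by auto
  ultimately show ?thesis using funpow_eq_sum_binomial[OF f, of p v] by simp
qed

text \<open>A projection onto \<open>W\<close>, averaged over the powers of \<open>T\<close>,
  commutes with \<open>T\<close> on \<open>V\<close>, and its kernel in \<open>V\<close> is the
  complement. \<open>V\<close> is kept apart from the ambient space because \<open>T\<close> is only
  assumed to have finite order on \<open>V\<close>.\<close>

lemma maschke_cyclic:
  assumes T: "Vector_Spaces.linear scale scale T" and V: "subspace V" "\<And>v. v \<in> V \<Longrightarrow> T v \<in> V"
    and r: "\<And>v. v \<in> V \<Longrightarrow> (T ^^ r) v = v" "of_nat r \<noteq> (0 :: 'a)"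
    and W: "subspace W" "W \<subseteq> V" "\<And>v. v \<in> W \<Longrightarrow> T v \<in> W"
  shows "\<exists>U. subspace U \<and> U \<subseteq> V \<and> (\<forall>u\<in>U. T u \<in> U) \<and> W \<inter> U = {0} \<and>
     (\<forall>v\<in>V. \<exists>w\<in>W. \<exists>u\<in>U. v = w + u)"
proof -
  interpret vector_space_pair scale scale ..
  obtain \<pi> where \<pi>: "\<pi> ` UNIV \<subseteq> W" "Vector_Spaces.linear scale scale \<pi>" "\<And>v. v \<in> W \<Longrightarrow> \<pi> v = v"
    using linear_exists_left_inverse_on[of id W] W local.linear_id by auto
  have Tn: "Vector_Spaces.linear scale scale (T ^^ i)" for i
  proof (induction i)
    case (Suc i)
    then show ?case using T by (simp add: Vector_Spaces.linear_iff)
  qed (simp add: Vector_Spaces.linear_iff vector_space_axioms)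
  \<comment> \<open>\<open>T ^^ (r - i)\<close> stands for the inverse of \<open>T ^^ i\<close> on
    \<open>V\<close>; for \<open>i = 0\<close> it is the full power \<open>r\<close>, which is the
    identity there.\<close>
  define \<sigma> where "\<sigma> v = scale (inverse (of_nat r)) (\<Sum>i<r. (T ^^ i) (\<pi> ((T ^^ (r - i)) v)))" for v
  have \<sigma>: "Vector_Spaces.linear scale scale \<sigma>"
    unfolding \<sigma>_def Vector_Spaces.linear_iff
    by (simp add: vector_space_axioms linear_add[OF Tn] linear_scale[OF Tn] linear_add[OF \<pi>(2)]
      linear_scale[OF \<pi>(2)] sum.distrib scale_right_distrib scale_sum_right mult.commute)
  have TW: "(T ^^ i) w \<in> W" if "w \<in> W" for i w
    by (induction i) (use that W in auto)
  have TV: "(T ^^ i) w \<in> V" if "w \<in> V" for i w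
    by (induction i) (use that V in auto)
  have \<sigma>W: "\<sigma> v \<in> W" for v
    unfolding \<sigma>_def using \<pi>(1) by (intro subspace_scale subspace_sum W(1) TW) auto
  have \<sigma>id: "\<sigma> w = w" if w: "w \<in> W" for w
  proof -
    have "(T ^^ i) (\<pi> ((T ^^ (r - i)) w)) = w" if "i < r" for i
    proof -
      have "(T ^^ i) (\<pi> ((T ^^ (r - i)) w)) = (T ^^ (i + (r - i))) w"
        using \<pi>(3)[OF TW[OF w]] by (simp only: funpow_add o_apply)
      then show ?thesis using that r(1) w W(2) by auto
    qed
    then have "\<sigma> w = scale (inverse (of_nat r)) (scale (of_nat r) w)"
      unfolding \<sigma>_def by (simp add: sum_constant_scale)
    then show ?thesis using r(2) by simp
  qed
  have \<sigma>T: "\<sigma> (T v) = T (\<sigma> v)" if v: "v \<in> V" for v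
  proof -
    let ?h = "\<lambda>i. (T ^^ i) (\<pi> ((T ^^ (r - i)) (T v)))"
    have r0: "r > 0" using r(2) by (cases r) auto
    have "T ((T ^^ i) (\<pi> ((T ^^ (r - i)) v))) = ?h (Suc i)" if "i < r" for i
    proof -
      have "(T ^^ (r - i)) v = (T ^^ (r - Suc i)) (T v)"
        using that by (metis Suc_diff_Suc funpow_Suc_right o_apply)
      then show ?thesis by simp
    qed
    then have "(\<Sum>i<r. T ((T ^^ i) (\<pi> ((T ^^ (r - i)) v)))) = (\<Sum>i<r. ?h (Suc i))"
      by simp
    also have "\<dots> = (\<Sum>i<Suc r. ?h i) - ?h 0"
      by (simp only: sum.lessThan_Suc_shift) simp
    also have "\<dots> = (\<Sum>i<r. ?h i) + ?h r - ?h 0" by simp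
    \<comment> \<open>The shifted sum differs from the original one by its two end terms; both equal
      \<open>\<pi> (T v)\<close>, because the \<open>r\<close>-th power is the identity on
      \<open>V\<close>.\<close>
    also have "?h r = ?h 0"
    proof -
      have "\<pi> (T v) \<in> V" using \<pi>(1) W(2) by blast
      then show ?thesis using r(1)[of "T v"] r(1)[of "\<pi> (T v)"] V(2)[OF v] by simp
    qed
    finally have "(\<Sum>i<r. T ((T ^^ i) (\<pi> ((T ^^ (r - i)) v)))) = (\<Sum>i<r. ?h i)" by simp
    then show ?thesis
      unfolding \<sigma>_def by (simp add: linear_scale[OF T] linear_sum[OF T])
  qed
  let ?U = "{v \<in> V. \<sigma> v = 0}"
  have "subspace ?U"
    using V(1) by (auto simp: subspace_def linear_add[OF \<sigma>] linear_scale[OF \<sigma>] linear_0[OF \<sigma>])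
  moreover have "\<forall>u\<in>?U. T u \<in> ?U" using V(2) \<sigma>T linear_0[OF T] by auto
  moreover have "W \<inter> ?U = {0}" using \<sigma>id W subspace_0 linear_0[OF \<sigma>] by auto
  moreover have "\<exists>w\<in>W. \<exists>u\<in>?U. v = w + u" if v: "v \<in> V" for v
  proof -
    have "\<sigma> v \<in> V" using \<sigma>W W(2) by blast
    then have "v - \<sigma> v \<in> V" using v V(1) by (intro subspace_diff)
    then have "v - \<sigma> v \<in> ?U" using \<sigma>id[OF \<sigma>W] by (simp add: linear_diff[OF \<sigma>])
    then show ?thesis using \<sigma>W by (metis add.commute diff_add_cancel)
  qed
  ultimately show ?thesis by blast
qed

end

section \<open>Composition series and elements of order prime to a prime\<close>

text \<open>Correspondence theorem: a normal subgroup of the quotient is a set \<open>A\<close> of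
  cosets whose union is normal in \<open>G\<close> and contains \<open>N\<close>, so maximality
  leaves only the two extremes.\<close>

lemma (in group) maximal_normal_imp_simple_Mod:
  assumes fin: "finite (carrier G)" and N: "N \<lhd> G" "N \<noteq> carrier G"
    and max: "\<And>L. L \<lhd> G \<Longrightarrow> N \<subseteq> L \<Longrightarrow> L = N \<or> L = carrier G"
  shows "simple_group (G Mod N)"
proof -
  interpret N: normal N G by (rule N(1))
  interpret Q: group "G Mod N" by (rule N.factorgroup_is_group)
  have one: "\<one>\<^bsub>G Mod N\<^esub> = N" by (simp add: FactGroup_def)
  have finQ: "finite (carrier (G Mod N))"
    using fin by (simp add: FactGroup_def RCOSETS_def)
  show ?thesis
  proof
    have "carrier (G Mod N) \<noteq> {\<one>\<^bsub>G Mod N\<^esub>}"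
      using N.fact_group_trivial_iff[OF fin] N(2) by simp
    then show "1 < Coset.order (G Mod N)"
      using finQ Q.order_one_triv_iff Q.order_gt_0_iff_finite by fastforce
  next
    fix A assume A: "A \<lhd> G Mod N"
    then have sA: "subgroup A (G Mod N)" by (rule normal_imp_subgroup)
    have UA: "\<Union>A = {x \<in> carrier G. N #> x \<in> A}"
      using sA by (rule N.factgroup_subgroup_union_char)
    have NA: "N \<in> A" using subgroup.one_closed[OF sA] one by simp
    have "A \<subseteq> carrier (G Mod N)" using sA by (rule subgroup.subset)
    then have cos: "\<exists>x\<in>carrier G. c = N #> x" if "c \<in> A" for c
      using that by (auto simp: FactGroup_def RCOSETS_def)
    have "\<Union>A = N \<or> \<Union>A = carrier G"
      using max[OF N.factgroup_subgroup_union_normal[OF A]] NA by blast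
    then show "A = carrier (G Mod N) \<or> A = {\<one>\<^bsub>G Mod N\<^esub>}"
    proof
      assume e: "\<Union>A = N"
      have cN: "c = N" if cA: "c \<in> A" for c
      proof -
        obtain x where x: "x \<in> carrier G" "c = N #> x" using cos[OF cA] by (elim bexE) (rule that)
        then have "x \<in> \<Union>A" unfolding UA using cA by simp
        then have "x \<in> N" by (simp only: e)
        then have "N #> x = N" by (rule N.rcos_const[OF is_group])
        then show ?thesis using x(2) by (simp only:)
      qed
      have "A = {N}"
      proof (intro equalityI subsetI)
        show "c \<in> {N}" if "c \<in> A" for c using cN[OF that] by simp
        show "c \<in> A" if "c \<in> {N}" for c using NA that by simp
      qed
      then show ?thesis using one by simp
    next
      assume e: "\<Union>A = carrier G"
      have "carrier (G Mod N) \<subseteq> A"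
        using e UA by (auto simp: FactGroup_def RCOSETS_def)
      then show ?thesis using \<open>A \<subseteq> carrier (G Mod N)\<close> by blast
    qed
  qed
qed

text \<open>\<open>p_solvable\<close> speaks about every composition series, so it yields
  information only once a series is exhibited. All subgroups \<open>K\<close> are treated at once,
  with the conditions stated in \<open>G\<close>, so that the induction can pass to a maximal normal
  subgroup of \<open>K\<close>.\<close>

lemma (in group) exists_subgroup_composition_series:
  assumes fin: "finite (carrier G)" and K: "subgroup K G"
  shows "\<exists>H m. H 0 = {\<one>} \<and> H m = K \<and>
     (\<forall>i<m. subgroup (H i) G \<and> subgroup (H (Suc i)) G \<and>
            H i \<lhd> (G\<lparr>carrier := H (Suc i)\<rparr>) \<and>
            simple_group ((G\<lparr>carrier := H (Suc i)\<rparr>) Mod (H i)))"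
  using K
proof (induction "card K" arbitrary: K rule: less_induct)
  case less
  show ?case
  proof (cases "K = {\<one>}")
    case True
    then show ?thesis by (intro exI[of _ "\<lambda>_. {\<one>}"] exI[of _ 0]) simp
  next
    case False
    let ?K = "G\<lparr>carrier := K\<rparr>"
    interpret K: group ?K by (rule subgroup_imp_group[OF less.prems])
    have finK: "finite K" using fin less.prems subgroup.subset finite_subset by metis
    let ?P = "\<lambda>N. N \<lhd> ?K \<and> N \<noteq> K"
    have "?P {\<one>}" using False K.one_is_normal by simp
    moreover have bd: "\<forall>N. ?P N \<longrightarrow> card N < Suc (card K)"
      using normal_imp_subgroup[of _ ?K] subgroup.subset[of _ ?K] finK
      by (auto simp: less_Suc_eq_le intro!: card_mono)
    ultimately obtain N where N: "?P N" and max: "\<And>L. ?P L \<Longrightarrow> card L \<le> card N"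
      using ex_has_greatest_nat[of ?P "{\<one>}" card "Suc (card K)"] by blast
    have NK: "subgroup N ?K" using N normal_imp_subgroup by blast
    then have NsubK: "N \<subset> K" using N subgroup.subset by fastforce
    have NG: "subgroup N G" using incl_subgroup[OF less.prems NK] .
    have simp: "simple_group (?K Mod N)"
    proof (rule K.maximal_normal_imp_simple_Mod)
      fix L assume L: "L \<lhd> ?K" "N \<subseteq> L"
      have "L \<subseteq> K" using L(1) normal_imp_subgroup subgroup.subset by fastforce
      then have "finite L" using finK finite_subset by blast
      show "L = N \<or> L = carrier ?K"
      proof (cases "L = K")
        case False
        then have "card L \<le> card N" using max L(1) by blast
        then show ?thesis using card_seteq[OF \<open>finite L\<close> L(2)] by blast
      qed simp
    qed (use N finK in auto)
    have "card N < card K" using NsubK finK by (rule psubset_card_mono[rotated])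
    then obtain H m where H: "H 0 = {\<one>}" "H m = N"
      "\<forall>i<m. subgroup (H i) G \<and> subgroup (H (Suc i)) G \<and>
            H i \<lhd> (G\<lparr>carrier := H (Suc i)\<rparr>) \<and>
            simple_group ((G\<lparr>carrier := H (Suc i)\<rparr>) Mod (H i))"
      using less.hyps NG by blast
    let ?H = "\<lambda>i. if i \<le> m then H i else K"
    have "subgroup (?H i) G \<and> subgroup (?H (Suc i)) G \<and>
            ?H i \<lhd> (G\<lparr>carrier := ?H (Suc i)\<rparr>) \<and>
            simple_group ((G\<lparr>carrier := ?H (Suc i)\<rparr>) Mod (?H i))" if "i < Suc m" for i
    proof (cases "i = m")
      case True
      then show ?thesis using H(2) N NG less.prems simp by simp
    next
      case False
      then show ?thesis using H(3) that by simp
    qed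
    then show ?thesis using H(1) by (intro exI[of _ ?H] exI[of _ "Suc m"]) simp
  qed
qed

lemma (in group) prime_order_imp_commute:
  assumes "Factorial_Ring.prime (Coset.order G)" "x \<in> carrier G" "y \<in> carrier G"
  shows "x \<otimes> y = y \<otimes> x"
proof (cases "x = \<one>")
  case False
  have fin: "finite (carrier G)"
    using order_gt_0_iff_finite prime_gt_0_nat[OF assms(1)] by simp
  have sub: "subgroup (generate G {x}) G" using assms(2) generate_is_subgroup by blast
  have "card (generate G {x}) dvd Coset.order G" using lagrange[OF sub] by (metis dvd_triv_right)
  moreover have "card (generate G {x}) \<noteq> 1"
  proof
    assume "card (generate G {x}) = 1"
    then obtain a where "generate G {x} = {a}" by (auto simp: card_1_singleton_iff)
    then show False
      using False generate.one[of G "{x}"] generate.incl[of x "{x}" G] by auto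
  qed
  ultimately have "card (generate G {x}) = Coset.order G"
    using assms(1) by (auto simp: prime_nat_iff)
  then have "generate G {x} = carrier G"
    using fin subgroup.subset[OF sub] by (simp add: card_subset_eq Coset.order_def)
  then obtain k :: int where "y = x [^] k"
    using assms generate_pow[OF assms(2)] by blast
  then show ?thesis using assms(2) by (metis int_pow_1 int_pow_mult add.commute)
qed (use assms in simp)

lemma (in normal) pow_card_Mod_mem:
  assumes "y \<in> carrier G"
  shows "y [^] card (carrier (G Mod H)) \<in> H"
proof -
  interpret Q: group "G Mod H" by (rule factorgroup_is_group)
  have c: "H #> y \<in> carrier (G Mod H)" using assms by (auto simp: FactGroup_def RCOSETS_def)
  have "H #> (y [^] Coset.order (G Mod H)) = \<one>\<^bsub>G Mod H\<^esub>"
    using Q.pow_order_eq_1[OF c] FactGroup_pow[OF assms] by simp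
  then have "H #> (y [^] Coset.order (G Mod H)) = H" by (simp add: FactGroup_def)
  then show ?thesis
    using coset_join1 assms subgroup_axioms by (metis nat_pow_closed Coset.order_def subset)
qed

lemma (in normal) prime_card_Mod_commutator_mem:
  assumes "Factorial_Ring.prime (card (carrier (G Mod H)))" "y \<in> carrier G" "z \<in> carrier G"
  shows "y \<otimes> z \<otimes> inv y \<otimes> inv z \<in> H"
proof -
  interpret Q: group "G Mod H" by (rule factorgroup_is_group)
  have c: "H #> y \<in> carrier (G Mod H)" "H #> z \<in> carrier (G Mod H)"
    using assms by (auto simp: FactGroup_def RCOSETS_def)
  have "(H #> y) \<otimes>\<^bsub>G Mod H\<^esub> (H #> z) = (H #> z) \<otimes>\<^bsub>G Mod H\<^esub> (H #> y)"
    using Q.prime_order_imp_commute c assms(1) by (simp add: Coset.order_def)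
  then have "H #> (y \<otimes> z) = H #> (z \<otimes> y)"
    using assms by (simp add: FactGroup_def rcos_sum)
  then have "y \<otimes> z \<in> H #> (z \<otimes> y)"
    using assms rcos_self subgroup_axioms by (metis m_closed)
  then obtain h where h: "h \<in> H" "y \<otimes> z = h \<otimes> (z \<otimes> y)" by (auto simp: r_coset_def)
  have hG: "h \<in> carrier G" using h(1) subset by blast
  have "y \<otimes> z \<otimes> inv y \<otimes> inv z = h \<otimes> (z \<otimes> y) \<otimes> inv y \<otimes> inv z" using h(2) by simp
  also have "\<dots> = h \<otimes> (z \<otimes> (y \<otimes> inv y) \<otimes> inv z)"
    using assms hG by (simp add: m_assoc del: r_inv l_inv)
  also have "\<dots> = h" using assms hG by simp
  finally show ?thesis using h(1) by simp
qed

section \<open>Elements of order prime to \<open>p\<close>, elements of \<open>p\<close>-power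
  order, and splitting an element into two such parts\<close>

definition p_regular :: "('g, 'b) monoid_scheme \<Rightarrow> nat \<Rightarrow> 'g set" where
  "p_regular G p = {x \<in> carrier G. \<exists>r. coprime r p \<and> x [^]\<^bsub>G\<^esub> r = \<one>\<^bsub>G\<^esub>}"

definition p_elements :: "('g, 'b) monoid_scheme \<Rightarrow> nat \<Rightarrow> 'g set" where
  "p_elements G p = {x \<in> carrier G. \<exists>j. x [^]\<^bsub>G\<^esub> (p ^ j) = \<one>\<^bsub>G\<^esub>}"

lemma (in group) subgroup_nat_pow_closed:
  "subgroup H G \<Longrightarrow> x \<in> H \<Longrightarrow> x [^] (k :: nat) \<in> H"
  by (induction k) (auto intro: subgroup.m_closed subgroup.one_closed)

lemma (in group) conj_nat_pow:
  assumes "g \<in> carrier G" "h \<in> carrier G"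
  shows "(g \<otimes> h \<otimes> inv g) [^] (k :: nat) = g \<otimes> h [^] k \<otimes> inv g"
proof (induction k)
  case (Suc k)
  have "inv g \<otimes> (g \<otimes> (h \<otimes> inv g)) = h \<otimes> inv g"
    using assms by (simp add: m_assoc[symmetric])
  then show ?case using Suc assms by (simp add: m_assoc)
qed (use assms in simp)

lemma (in group) conj_commutator:
  assumes "g \<in> carrier G" "a \<in> carrier G" "b \<in> carrier G"
  shows "g \<otimes> (a \<otimes> b \<otimes> inv a \<otimes> inv b) \<otimes> inv g =
    (g \<otimes> a \<otimes> inv g) \<otimes> (g \<otimes> b \<otimes> inv g) \<otimes> inv (g \<otimes> a \<otimes> inv g) \<otimes> inv (g \<otimes> b \<otimes> inv g)"
proof -
  have c: "inv g \<otimes> (g \<otimes> x) = x" if "x \<in> carrier G" for x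
    using assms(1) that by (simp add: m_assoc[symmetric])
  show ?thesis using assms by (simp add: inv_mult_group m_assoc c)
qed

text \<open>By Bezout some multiple of \<open>r\<close> exceeds a multiple of \<open>s\<close> by
  exactly 1; \<open>r \<noteq> 0\<close> makes this possible with natural numbers.\<close>

lemma (in group) coprime_power_mem:
  assumes "subgroup H G" "x \<in> carrier G" "x [^] r \<in> H" "x [^] s \<in> H" "coprime r (s :: nat)" "r \<noteq> 0"
  shows "x \<in> H"
proof -
  obtain a b where ab: "r * a = s * b + 1" using bezout_nat[OF assms(6), of s] assms(5) by auto
  have 1: "x [^] (r * a) \<in> H" using assms(1,2,3) 
    by (simp add: nat_pow_pow[symmetric] subgroup_nat_pow_closed)
  have 2: "x [^] (s * b) \<in> H" using assms(1,2,4)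
    by (simp add: nat_pow_pow[symmetric] subgroup_nat_pow_closed)
  have "x [^] (r * a) = x [^] (s * b) \<otimes> x" using ab assms(2) by simp
  then have "x = inv (x [^] (s * b)) \<otimes> x [^] (r * a)"
    using assms(2) by (simp add: m_assoc[symmetric])
  then show ?thesis using 1 2 assms(1) by (metis subgroup.m_closed subgroup.m_inv_closed)
qed

text \<open>Only these closure properties of a composition series are needed. They pass from \<open>H (Suc i)\<close> to its
  subgroups, so a normal subgroup need not itself come with a composition series.\<close>

definition p_chain :: "('g, 'b) monoid_scheme \<Rightarrow> nat \<Rightarrow> (nat \<Rightarrow> 'g set) \<Rightarrow> nat \<Rightarrow> bool" where
  "p_chain G p H m \<longleftrightarrow> H 0 = {\<one>\<^bsub>G\<^esub>} \<and> H m = carrier G \<and>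
    (\<forall>i<m. subgroup (H i) G \<and>
      ((\<forall>y\<in>H (Suc i). y [^]\<^bsub>G\<^esub> p \<in> H i) \<and>
       (\<forall>y\<in>H (Suc i). \<forall>z\<in>H (Suc i).
          y \<otimes>\<^bsub>G\<^esub> z \<otimes>\<^bsub>G\<^esub> inv\<^bsub>G\<^esub> y \<otimes>\<^bsub>G\<^esub> inv\<^bsub>G\<^esub> z \<in> H i)
       \<or> H (Suc i) \<inter> p_elements G p \<subseteq> H i))"

lemma (in group) p_solvable_imp_p_chain:
  assumes fin: "finite (carrier G)" and p: "Factorial_Ring.prime p" and ps: "p_solvable G p"
  shows "\<exists>H m. p_chain G p H m"
proof -
  obtain H m where H: "H 0 = {\<one>}" "H m = carrier G"
    and st: "\<And>i. i < m \<Longrightarrow> subgroup (H i) G \<and> subgroup (H (Suc i)) G \<and>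
            H i \<lhd> (G\<lparr>carrier := H (Suc i)\<rparr>) \<and>
            simple_group ((G\<lparr>carrier := H (Suc i)\<rparr>) Mod (H i))"
    using exists_subgroup_composition_series[OF fin subgroup_self] by blast
  have "composition_series G H m" using H st by (simp add: composition_series_def)
  then have ord: "comp_factor_order G H i = p \<or> coprime (comp_factor_order G H i) p" if "i < m" for i
    using ps that by (simp add: p_solvable_def)
  have *: "(\<forall>y\<in>H (Suc i). y [^] p \<in> H i) \<and>
       (\<forall>y\<in>H (Suc i). \<forall>z\<in>H (Suc i). y \<otimes> z \<otimes> inv y \<otimes> inv z \<in> H i)
       \<or> H (Suc i) \<inter> p_elements G p \<subseteq> H i" if i: "i < m" for i
  proof -
    let ?K = "G\<lparr>carrier := H (Suc i)\<rparr>"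
    have s: "subgroup (H i) G" "subgroup (H (Suc i)) G" and n: "H i \<lhd> ?K" using st[OF i] by auto
    interpret n: normal "H i" ?K by (rule n)
    let ?q = "card (carrier (?K Mod H i))"
    have q: "?q = p \<or> coprime ?q p" using ord[OF i] by (simp add: comp_factor_order_def)
    have pow: "y [^] ?q \<in> H i" if "y \<in> H (Suc i)" for y
      using n.pow_card_Mod_mem[of y] that by (simp add: nat_pow_consistent[symmetric])
    show ?thesis
    proof (cases "?q = p")
      case True
      have "y \<otimes> z \<otimes> inv y \<otimes> inv z \<in> H i" if "y \<in> H (Suc i)" "z \<in> H (Suc i)" for y z
        using n.prime_card_Mod_commutator_mem[of y z] that p True m_inv_consistent[OF s(2)] by simp
      then show ?thesis using pow True by auto
    next
      case False
      then have cop: "coprime ?q p" using q by simp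
      have "?q \<noteq> 0"
      proof
        assume "?q = 0"
        then show False using cop p by (simp del: card_eq_0_iff)
      qed
      \<comment> \<open>Two powers of \<open>y\<close> with coprime exponents lie in
        \<open>H i\<close>: elements of \<open>p\<close>-power order become trivial in a quotient of
        order prime to \<open>p\<close>.\<close>
      have "y \<in> H i" if y: "y \<in> H (Suc i)" "y \<in> p_elements G p" for y
      proof -
        obtain j where "y [^] (p ^ j) = \<one>" "y \<in> carrier G" using y by (auto simp: p_elements_def)
        moreover have "coprime ?q (p ^ j)" using cop by simp
        ultimately show ?thesis
          using coprime_power_mem[OF s(1) _ pow[OF y(1)] _ _ \<open>?q \<noteq> 0\<close>] subgroup.one_closed[OF s(1)] by metis
      qed
      then show ?thesis by blast
    qed
  qed
  have "p_chain G p H m"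
    unfolding p_chain_def using H st * by simp
  then show ?thesis by blast
qed

lemma (in group) p_regular_p_element_decomposition:
  assumes fin: "finite (carrier G)" and p: "Factorial_Ring.prime p" and z: "z \<in> carrier G"
  shows "\<exists>a b. z [^] (a :: nat) \<in> p_regular G p \<and> z [^] (b :: nat) \<in> p_elements G p \<and>
    z = z [^] a \<otimes> z [^] b"
proof -
  have o0: "Coset.order G \<noteq> 0" using fin order_gt_0_iff_finite by simp
  have up: "\<not> is_unit p" using p by auto
  then obtain r where r: "Coset.order G = p ^ multiplicity p (Coset.order G) * r" "\<not> p dvd r"
    using multiplicity_decompose'[OF o0 up] by metis
  define k where "k = multiplicity p (Coset.order G)"
  have o: "Coset.order G = p ^ k * r" using r(1) k_def by simp
  have cop: "coprime r p" using r(2) p prime_imp_coprime by (metis coprime_commute)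
  have "p ^ k \<noteq> 0" using p by auto
  then obtain x y where xy: "p ^ k * x = r * y + 1"
    using bezout_nat[of "p ^ k" r] cop by (auto simp: coprime_commute)
  \<comment> \<open>\<open>?a\<close> is 0 modulo \<open>p ^ k\<close> and 1 modulo
    \<open>r\<close>. The other exponent should be \<open>1 - ?a\<close>, that is, minus
    \<open>r * y\<close>; the factor \<open>Coset.order G - 1\<close> acts as minus 1 modulo the
    group order and keeps the exponent natural.\<close>
  let ?a = "p ^ k * x" and ?b = "r * y * (Coset.order G - 1)"
  have e: "z [^] (Coset.order G * j) = \<one>" for j
    using z pow_order_eq_1[OF z] by (simp add: nat_pow_pow[symmetric])
  have "(z [^] ?a) [^] r = z [^] (Coset.order G * x)" using z by (simp add: nat_pow_pow o mult_ac)
  then have 1: "z [^] ?a \<in> p_regular G p" using z e cop by (auto simp: p_regular_def)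
  have "(z [^] ?b) [^] (p ^ k) = z [^] (Coset.order G * (y * (Coset.order G - 1)))"
    using z by (simp add: nat_pow_pow o mult_ac)
  then have 2: "z [^] ?b \<in> p_elements G p" using z e by (auto simp: p_elements_def)
  have "?a + ?b = Coset.order G * (r * y) + 1"
    using xy o0 by (cases "Coset.order G") (simp_all add: algebra_simps)
  then have "z [^] ?a \<otimes> z [^] ?b = z" using z e[of "r * y"] by (simp add: nat_pow_mult)
  then show ?thesis using 1 2 by metis
qed

lemma (in group) mult_pow_normal:
  assumes N: "N \<lhd> G" and x: "x \<in> carrier G" and y: "y \<in> N"
  shows "\<exists>w\<in>N. (x \<otimes> y) [^] (j :: nat) = x [^] j \<otimes> w"
proof (induction j)
  case 0
  then show ?case using N subgroup.one_closed[OF normal_imp_subgroup] by force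
next
  case (Suc j)
  interpret N: normal N G by (rule N)
  obtain w where w: "w \<in> N" "(x \<otimes> y) [^] j = x [^] j \<otimes> w" using Suc by blast
  have c: "w \<in> carrier G" "y \<in> carrier G" using w y N.subset by auto
  have "(x \<otimes> y) [^] Suc j = x [^] j \<otimes> w \<otimes> (x \<otimes> y)" using w by simp
  also have "\<dots> = x [^] Suc j \<otimes> (inv x \<otimes> w \<otimes> x \<otimes> y)"
    using c x by (simp add: m_assoc inv_solve_left)
      (simp add: m_assoc[symmetric])
  finally show ?case using N.inv_op_closed1[OF x w(1)] N.m_closed y by blast
qed

text \<open>\<open>x'\<close> and \<open>w\<close> are the parts of \<open>x \<otimes> y\<close> of
  order prime to \<open>p\<close> and of \<open>p\<close>-power order. Modulo \<open>N\<close> the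
  product agrees with \<open>x\<close>, whose order is prime to \<open>p\<close>, so the second part
  is trivial there and lies in \<open>N\<close>.\<close>

lemma (in group) p_regular_mult_normal:
  assumes fin: "finite (carrier G)" and p: "Factorial_Ring.prime p"
    and N: "N \<lhd> G" and x: "x \<in> p_regular G p" and y: "y \<in> N"
  shows "\<exists>x'\<in>p_regular G p. \<exists>w\<in>N \<inter> p_elements G p. x \<otimes> y = x' \<otimes> w"
proof -
  interpret N: normal N G by (rule N)
  have c: "x \<in> carrier G" "y \<in> carrier G" using x y N.subset by (auto simp: p_regular_def)
  let ?z = "x \<otimes> y"
  obtain a b where ab: "?z [^] (a :: nat) \<in> p_regular G p" "?z [^] (b :: nat) \<in> p_elements G p"
    "?z = ?z [^] a \<otimes> ?z [^] b"
    using p_regular_p_element_decomposition[OF fin p, of ?z] c by blast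
  obtain s where s: "coprime s p" "x [^] s = \<one>" using x by (auto simp: p_regular_def)
  have s0: "s \<noteq> 0" using s(1) p by (cases s) auto
  obtain j where j: "(?z [^] b) [^] (p ^ j) = \<one>" using ab(2) by (auto simp: p_elements_def)
  have "?z [^] s \<in> N"
    using mult_pow_normal[OF N c(1) y, of s] s(2) N.subset by auto
  then have "(?z [^] s) [^] b \<in> N" by (rule subgroup_nat_pow_closed[OF N.subgroup_axioms])
  then have "(?z [^] b) [^] s \<in> N" using c by (simp add: nat_pow_pow mult.commute)
  moreover have "(?z [^] b) [^] (p ^ j) \<in> N" using j by simp
  moreover have "coprime s (p ^ j)" using s(1) by simp
  ultimately have "?z [^] b \<in> N"
    using coprime_power_mem[OF N.subgroup_axioms _ _ _ _ s0] c by blast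
  then show ?thesis using ab by blast
qed

section \<open>Matrices and the double commutant\<close>

text \<open>Square matrices are functions supported on \<open>{..<n} \<times> {..<n}\<close>, since the matrices of
  \<open>Jordan_Normal_Form\<close> do not form a type in class \<open>ab_group_add\<close>, as \<open>vector_space\<close> requires.\<close>

definition mscale :: "'a::field \<Rightarrow> (nat \<Rightarrow> nat \<Rightarrow> 'a) \<Rightarrow> nat \<Rightarrow> nat \<Rightarrow> 'a" where
  "mscale c A = (\<lambda>i j. c * A i j)"

definition mmul :: "nat \<Rightarrow> (nat \<Rightarrow> nat \<Rightarrow> 'a::field) \<Rightarrow> (nat \<Rightarrow> nat \<Rightarrow> 'a) \<Rightarrow> nat \<Rightarrow> nat \<Rightarrow> 'a" where
  "mmul n A B = (\<lambda>i j. \<Sum>l<n. A i l * B l j)"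

definition mone :: "nat \<Rightarrow> nat \<Rightarrow> nat \<Rightarrow> 'a::field" where
  "mone n = (\<lambda>i j. if i = j \<and> i < n then 1 else 0)"

definition munit :: "nat \<Rightarrow> nat \<Rightarrow> nat \<Rightarrow> nat \<Rightarrow> 'a::field" where
  "munit a b = (\<lambda>i j. if i = a \<and> j = b then 1 else 0)"

definition mtrace :: "nat \<Rightarrow> (nat \<Rightarrow> nat \<Rightarrow> 'a::field) \<Rightarrow> 'a" where
  "mtrace n A = (\<Sum>i<n. A i i)"

definition msquare :: "nat \<Rightarrow> (nat \<Rightarrow> nat \<Rightarrow> 'a::field) set" where
  "msquare n = {A. \<forall>i j. A i j \<noteq> 0 \<longrightarrow> i < n \<and> j < n}"

definition commutant :: "nat \<Rightarrow> (nat \<Rightarrow> nat \<Rightarrow> 'a::field) set \<Rightarrow> (nat \<Rightarrow> nat \<Rightarrow> 'a) set" where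
  "commutant n S = {A \<in> msquare n. \<forall>s\<in>S. mmul n A s = mmul n s A}"

interpretation fm: operator_space "mscale :: 'a::field \<Rightarrow> (nat \<Rightarrow> nat \<Rightarrow> 'a) \<Rightarrow> nat \<Rightarrow> nat \<Rightarrow> 'a"
  by unfold_locales (auto simp: mscale_def fun_eq_iff algebra_simps)

interpretation fmp: vector_space_pair "mscale :: 'a::field \<Rightarrow> (nat \<Rightarrow> nat \<Rightarrow> 'a) \<Rightarrow> nat \<Rightarrow> nat \<Rightarrow> 'a"
    "mscale :: 'a::field \<Rightarrow> (nat \<Rightarrow> nat \<Rightarrow> 'a) \<Rightarrow> nat \<Rightarrow> nat \<Rightarrow> 'a"
  ..

lemma sum_fun_apply: "(\<Sum>x\<in>A. f x) i = (\<Sum>x\<in>A. f x i)"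
  by (induction A rule: infinite_finite_induct) auto

lemma mmul_assoc: "mmul n (mmul n A B) C = mmul n A (mmul n B C)"
proof (intro ext)
  fix i j
  have "mmul n (mmul n A B) C i j = (\<Sum>l<n. \<Sum>m<n. A i m * (B m l * C l j))"
    by (simp add: mmul_def sum_distrib_right mult.assoc)
  also have "\<dots> = (\<Sum>m<n. \<Sum>l<n. A i m * (B m l * C l j))" by (rule sum.swap)
  finally show "mmul n (mmul n A B) C i j = mmul n A (mmul n B C) i j"
    by (simp add: mmul_def sum_distrib_left)
qed

lemma mmul_add_left: "mmul n (A + B) C = mmul n A C + mmul n B C"
  and mmul_add_right: "mmul n C (A + B) = mmul n C A + mmul n C B"
  and mmul_diff_left: "mmul n (A - B) C = mmul n A C - mmul n B C"
  and mmul_diff_right: "mmul n C (A - B) = mmul n C A - mmul n C B"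
  by (simp_all add: mmul_def fun_eq_iff sum.distrib sum_subtractf algebra_simps)

lemma mmul_scale_left: "mmul n (mscale c A) B = mscale c (mmul n A B)"
  and mmul_scale_right: "mmul n A (mscale c B) = mscale c (mmul n A B)"
  by (simp_all add: mmul_def mscale_def fun_eq_iff sum_distrib_left mult_ac)

lemma mmul_zero [simp]: "mmul n 0 A = 0" "mmul n A 0 = 0"
  by (simp_all add: mmul_def fun_eq_iff)

lemma linear_mmul_left: "Vector_Spaces.linear mscale mscale (mmul n A)"
  and linear_mmul_right: "Vector_Spaces.linear mscale mscale (\<lambda>B. mmul n B A)"
  and linear_mmul_both: "Vector_Spaces.linear mscale mscale (\<lambda>B. mmul n A (mmul n B C))"
  by (simp_all add: Vector_Spaces.linear_iff fm.vector_space_axioms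
      mmul_add_left mmul_add_right mmul_scale_left mmul_scale_right)

lemma mtrace_mmul_commute: "mtrace n (mmul n A B) = mtrace n (mmul n B A)"
proof -
  have "mtrace n (mmul n A B) = (\<Sum>i<n. \<Sum>l<n. A i l * B l i)"
    by (simp add: mtrace_def mmul_def)
  also have "\<dots> = (\<Sum>l<n. \<Sum>i<n. A i l * B l i)" by (rule sum.swap)
  finally show ?thesis by (simp add: mtrace_def mmul_def mult.commute)
qed

lemma mtrace_add: "mtrace n (A + B) = mtrace n A + mtrace n B"
  and mtrace_diff: "mtrace n (A - B) = mtrace n A - mtrace n B"
  and mtrace_scale: "mtrace n (mscale c A) = c * mtrace n A"
  and mtrace_zero: "mtrace n 0 = 0"
  by (simp_all add: mtrace_def mscale_def sum.distrib sum_subtractf sum_distrib_left)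

lemma mtrace_mone: "mtrace n (mone n) = of_nat n"
  by (simp add: mtrace_def mone_def)

lemma subspace_msquare: "fm.subspace (msquare n)"
  by (auto simp: fm.subspace_def msquare_def mscale_def) (metis add.right_neutral)+

lemma msquare_eq_0: "A \<in> msquare n \<Longrightarrow> \<not> (i < n \<and> j < n) \<Longrightarrow> A i j = 0"
  by (auto simp: msquare_def)

lemma mmul_msquare: "A \<in> msquare n \<Longrightarrow> B \<in> msquare n \<Longrightarrow> mmul n A B \<in> msquare n"
  unfolding msquare_def mmul_def mem_Collect_eq
  by (intro allI impI) (metis (no_types, lifting) mult_eq_0_iff sum.neutral)

lemma mone_msquare: "mone n \<in> msquare n"
  by (simp add: mone_def msquare_def)

lemma munit_msquare: "a < n \<Longrightarrow> b < n \<Longrightarrow> munit a b \<in> msquare n"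
  by (simp add: munit_def msquare_def)

lemma mmul_mone:
  assumes "A \<in> msquare n"
  shows "mmul n (mone n) A = A" "mmul n A (mone n) = A"
proof -
  have "(\<Sum>l<n. (if i = l \<and> i < n then 1 else 0) * A l j) = (\<Sum>l<n. if l = i then A i j else 0)" for i j
    by (rule sum.cong) auto
  then show "mmul n (mone n) A = A"
    using msquare_eq_0[OF assms] by (auto simp: mmul_def mone_def fun_eq_iff)
  have "(\<Sum>l<n. A i l * (if l = j \<and> l < n then 1 else 0)) = (\<Sum>l<n. if l = j then A i j else 0)" for i j
    by (rule sum.cong) auto
  then show "mmul n A (mone n) = A"
    using msquare_eq_0[OF assms] by (auto simp: mmul_def mone_def fun_eq_iff)
qed

lemma msquare_expand:
  assumes "A \<in> msquare n"
  shows "A = (\<Sum>i<n. \<Sum>b<n. mscale (A b i) (munit b i))"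
proof (intro ext)
  fix a j
  have "(\<Sum>i<n. \<Sum>b<n. mscale (A b i) (munit b i)) a j = (\<Sum>i<n. \<Sum>b<n. A b i * munit b i a j)"
    by (simp add: sum_fun_apply mscale_def)
  also have "\<dots> = (\<Sum>i<n. if i = j then (\<Sum>b<n. if b = a then A a j else 0) else 0)"
  proof (rule sum.cong[OF refl])
    fix i
    have "(\<Sum>b<n. A b i * munit b i a j) = (\<Sum>b<n. if i = j then if b = a then A a j else 0 else 0)"
      by (rule sum.cong) (auto simp: munit_def)
    then show "(\<Sum>b<n. A b i * munit b i a j) =
        (if i = j then \<Sum>b<n. if b = a then A a j else 0 else 0)" by simp
  qed
  also have "\<dots> = A a j"
    using msquare_eq_0[OF assms] by auto
  finally show "A a j = (\<Sum>i<n. \<Sum>b<n. mscale (A b i) (munit b i)) a j" ..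
qed

lemma msquare_span_munit: "msquare n \<subseteq> fm.span ((\<lambda>(a, b). munit a b) ` ({..<n} \<times> {..<n}))"
proof
  fix A :: "nat \<Rightarrow> nat \<Rightarrow> 'a" assume "A \<in> msquare n"
  then have "A = (\<Sum>i<n. \<Sum>b<n. mscale (A b i) (munit b i))" by (rule msquare_expand)
  also have "\<dots> \<in> fm.span ((\<lambda>(a, b). munit a b) ` ({..<n} \<times> {..<n}))"
    by (intro fm.span_sum fm.span_scale fm.span_base) force
  finally show "A \<in> fm.span ((\<lambda>(a, b). munit a b) ` ({..<n} \<times> {..<n}))" .
qed

lemma mmul_munit:
  assumes "A \<in> msquare n" "b < n"
  shows "mmul n A (munit b i) = (\<Sum>l<n. mscale (A l b) (munit l i))"
proof (intro ext)
  fix a j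
  have "mmul n A (munit b i) a j = (\<Sum>l<n. if l = b then (if j = i then A a b else 0) else 0)"
    unfolding mmul_def by (rule sum.cong) (auto simp: munit_def)
  also have "\<dots> = (if j = i then A a b else 0)" using assms(2) by simp
  also have "\<dots> = (\<Sum>l<n. if l = a then (if j = i then A a b else 0) else 0)"
    using msquare_eq_0[OF assms(1)] by auto
  also have "\<dots> = (\<Sum>l<n. mscale (A l b) (munit l i) a j)"
    by (rule sum.cong) (auto simp: mscale_def munit_def)
  finally show "mmul n A (munit b i) a j = (\<Sum>l<n. mscale (A l b) (munit l i)) a j"
    by (simp add: sum_fun_apply)
qed

lemma munit_mmul:
  assumes "A \<in> msquare n" "a < n" "b < n"
  shows "mmul n (mmul n (munit i a) A) (munit b j) = mscale (A a b) (munit i j)"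
proof (intro ext)
  fix r s
  have inner: "mmul n (munit i a) A r l = (if r = i then A a l else 0)" for l
  proof -
    have "mmul n (munit i a) A r l = (\<Sum>m<n. if m = a then (if r = i then A a l else 0) else 0)"
      unfolding mmul_def by (rule sum.cong) (auto simp: munit_def)
    then show ?thesis using assms by simp
  qed
  have "mmul n (mmul n (munit i a) A) (munit b j) r s
      = (\<Sum>l<n. if l = b then (if r = i \<and> s = j then A a b else 0) else 0)"
    unfolding mmul_def[of n "mmul n (munit i a) A"] by (rule sum.cong) (auto simp: inner, auto simp: munit_def)
  then show "mmul n (mmul n (munit i a) A) (munit b j) r s = mscale (A a b) (munit i j) r s"
    using assms by (simp add: mscale_def munit_def)
qed

text \<open>The matrix algebra is simple: matrix units on both sides isolate one non-zero entry and
  move it to any position.\<close>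

lemma two_sided_ideal_msquare:
  assumes J: "fm.subspace J" "J \<subseteq> msquare n" "J \<noteq> {0}"
    and ideal: "\<And>A B. A \<in> J \<Longrightarrow> B \<in> msquare n \<Longrightarrow> mmul n B A \<in> J \<and> mmul n A B \<in> J"
  shows "J = msquare n"
proof -
  obtain A where A: "A \<in> J" "A \<noteq> 0" using J(1,3) fm.subspace_0 by blast
  then obtain a b where ab: "A a b \<noteq> 0" by (auto simp: fun_eq_iff)
  have An: "A \<in> msquare n" using A J by blast
  then have lt: "a < n" "b < n" using ab by (auto simp: msquare_def)
  have "munit i j \<in> J" if "i < n" "j < n" for i j
  proof -
    have "mmul n (mmul n (munit i a) A) (munit b j) \<in> J"
      using ideal A lt that munit_msquare by metis
    then have "mscale (inverse (A a b)) (mscale (A a b) (munit i j)) \<in> J"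
      using J(1) fm.subspace_scale munit_mmul[OF An lt] by metis
    then show ?thesis using ab by simp
  qed
  then have "(\<lambda>(a, b). munit a b) ` ({..<n} \<times> {..<n}) \<subseteq> J" by auto
  then have "fm.span ((\<lambda>(a, b). munit a b) ` ({..<n} \<times> {..<n})) \<subseteq> J"
    using J(1) by (rule fm.span_minimal)
  then show ?thesis using msquare_span_munit J(2) by blast
qed

lemma stable_span:
  assumes "\<And>s t. s \<in> S \<Longrightarrow> t \<in> S \<Longrightarrow> mmul n s t \<in> S"
  shows "fm.stable (mmul n ` S) (fm.span S)"
proof -
  have "fm.span S \<subseteq> {b. mmul n s b \<in> fm.span S}" if "s \<in> S" for s
    using assms[OF that] fm.span_base
    by (intro fm.span_minimal fmp.linear_subspace_linear_preimage[OF linear_mmul_left] fm.subspace_span) blast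
  then show ?thesis unfolding fm.stable_def using fm.subspace_span by blast
qed

text \<open>The projection onto \<open>span S\<close> along an \<open>S\<close>-stable complement acts on the columns of a matrix
  through blocks that lie in the commutant of \<open>S\<close>, so it commutes with left multiplication by every
  matrix that centralises the commutant.\<close>

lemma double_commutant:
  assumes S: "S \<subseteq> msquare n" "mone n \<in> S" "\<And>s t. s \<in> S \<Longrightarrow> t \<in> S \<Longrightarrow> mmul n s t \<in> S"
    and U: "fm.stable (mmul n ` S) U" "fm.span S \<inter> U = {0}"
      "msquare n \<subseteq> {x + u |x u. x \<in> fm.span S \<and> u \<in> U}"
    and c: "c \<in> msquare n" "\<And>A. A \<in> commutant n S \<Longrightarrow> mmul n c A = mmul n A c"
  shows "c \<in> fm.span S"
proof -
  define B where "B = fm.span S"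
  have Bsub: "fm.subspace B" unfolding B_def by (rule fm.subspace_span)
  have Usub: "fm.subspace U" using U(1) by (simp add: fm.stable_def)
  have Bn: "B \<subseteq> msquare n"
    unfolding B_def using S(1) subspace_msquare by (rule fm.span_minimal)
  have B1: "mone n \<in> B" unfolding B_def using S(2) by (rule fm.span_base)
  have sB: "mmul n s b \<in> B" if "s \<in> S" "b \<in> B" for s b
    using stable_span[of S n, OF S(3)] that by (auto simp: B_def fm.stable_def)
  have sU: "mmul n s u \<in> U" if "s \<in> S" "u \<in> U" for s u
    using U(1) that by (auto simp: fm.stable_def)
  \<comment> \<open>The choice is unique on \<open>msquare n\<close> because \<open>B\<close> and
    \<open>U\<close> meet only in 0; linearity and compatibility with \<open>S\<close> are all read
    off from this uniqueness, in the form \<open>\<pi>_eq\<close>.\<close>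
  define \<pi> where "\<pi> A = (SOME x. x \<in> B \<and> A - x \<in> U)" for A
  have \<pi>: "\<pi> A \<in> B" "A - \<pi> A \<in> U" if "A \<in> msquare n" for A
  proof -
    have "\<exists>x. x \<in> B \<and> A - x \<in> U" using U(3) that unfolding B_def by fastforce
    then have "\<pi> A \<in> B \<and> A - \<pi> A \<in> U" unfolding \<pi>_def by (rule someI_ex)
    then show "\<pi> A \<in> B" "A - \<pi> A \<in> U" by auto
  qed
  have \<pi>_eq: "\<pi> A = x" if "A \<in> msquare n" "x \<in> B" "A - x \<in> U" for A x
  proof -
    have "\<pi> A - x \<in> B" using \<pi>(1)[OF that(1)] that(2) Bsub fm.subspace_diff by blast
    moreover have "(A - x) - (A - \<pi> A) \<in> U" using \<pi>(2)[OF that(1)] that(3) Usub fm.subspace_diff by blast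
    then have "\<pi> A - x \<in> U" by simp
    ultimately have "\<pi> A - x \<in> {0}" using U(2) unfolding B_def by blast
    then show ?thesis by simp
  qed
  have \<pi>_add: "\<pi> (A + A') = \<pi> A + \<pi> A'" if "A \<in> msquare n" "A' \<in> msquare n" for A A'
  proof (rule \<pi>_eq)
    show "A + A' - (\<pi> A + \<pi> A') \<in> U"
      using fm.subspace_add[OF Usub \<pi>(2)[OF that(1)] \<pi>(2)[OF that(2)]] by (simp add: algebra_simps)
  qed (use that \<pi> Bsub subspace_msquare fm.subspace_add in blast)+
  have \<pi>_scale: "\<pi> (mscale x A) = mscale x (\<pi> A)" if "A \<in> msquare n" for A x
  proof (rule \<pi>_eq)
    show "mscale x A - mscale x (\<pi> A) \<in> U"
      using fm.subspace_scale[OF Usub \<pi>(2)[OF that]] by (simp add: fm.scale_right_diff_distrib)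
  qed (use that \<pi> Bsub subspace_msquare fm.subspace_scale in blast)+
  have \<pi>_mul: "\<pi> (mmul n s A) = mmul n s (\<pi> A)" if "A \<in> msquare n" "s \<in> S" for A s
  proof (rule \<pi>_eq)
    show "mmul n s A - mmul n s (\<pi> A) \<in> U"
      using sU[OF that(2) \<pi>(2)[OF that(1)]] by (simp add: mmul_diff_right)
  qed (use that \<pi> sB S(1) mmul_msquare in blast)+
  have \<pi>_id: "\<pi> b = b" if "b \<in> B" for b
    using \<pi>_eq[of b b] that Bn fm.subspace_0[OF Usub] by auto
  have \<pi>_sum: "\<pi> (\<Sum>i<k. f i) = (\<Sum>i<k. \<pi> (f i))"
    if "\<And>i. i < k \<Longrightarrow> f i \<in> msquare n" for k :: nat and f
    using that
  proof (induction k)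
    case 0
    have "\<pi> 0 = 0" by (rule \<pi>_id) (rule fm.subspace_0[OF Bsub])
    then show ?case by (simp only: lessThan_0 sum.empty)
  next
    case (Suc k)
    have "(\<Sum>i<k. f i) \<in> msquare n" using Suc.prems by (intro fm.subspace_sum[OF subspace_msquare]) auto
    then show ?case using Suc by (simp only: sum.lessThan_Suc \<pi>_add less_Suc_eq simp_thms)
  qed
  \<comment> \<open>Block decomposition of \<open>\<pi>\<close>: column \<open>j\<close> of
    \<open>\<pi> A\<close> is the sum over \<open>i\<close> of \<open>P i j\<close> applied to
    column \<open>i\<close> of \<open>A\<close>, so the entries of \<open>P i j\<close> come from
    the values of \<open>\<pi>\<close> on matrix units in column \<open>i\<close>.\<close>
  define P where "P i j = (\<lambda>a b. if a < n \<and> b < n then \<pi> (munit b i) a j else 0)" for i j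
  have P_comm: "P i j \<in> commutant n S" if "i < n" "j < n" for i j
    unfolding commutant_def
  proof (intro CollectI conjI ballI)
    show "P i j \<in> msquare n" by (simp add: P_def msquare_def)
    fix s assume s: "s \<in> S"
    then have sn: "s \<in> msquare n" using S(1) by blast
    show "mmul n (P i j) s = mmul n s (P i j)"
    proof (intro ext)
      fix a b
      consider "a < n" "b < n" | "\<not> a < n" | "\<not> b < n" by blast
      then show "mmul n (P i j) s a b = mmul n s (P i j) a b"
      proof cases
        case 1
        have "mmul n s (P i j) a b = mmul n s (\<pi> (munit b i)) a j"
          using 1 by (simp add: mmul_def P_def)
        also have "\<dots> = \<pi> (mmul n s (munit b i)) a j"
          using \<pi>_mul[OF munit_msquare s] 1 that by simp
        also have "\<dots> = (\<Sum>l<n. mscale (s l b) (\<pi> (munit l i))) a j"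
          using that 1 by (simp add: mmul_munit[OF sn] \<pi>_sum \<pi>_scale munit_msquare
              fm.subspace_scale[OF subspace_msquare])
        also have "\<dots> = mmul n (P i j) s a b"
          using 1 by (simp add: sum_fun_apply mscale_def mmul_def P_def mult.commute)
        finally show ?thesis ..
      qed (use msquare_eq_0[OF sn] in \<open>auto simp: mmul_def P_def\<close>)
    qed
  qed
  have \<pi>_P: "\<pi> A a j = (\<Sum>i<n. mmul n (P i j) A a i)" if "A \<in> msquare n" "a < n" "j < n" for A a j
  proof -
    let ?e = "\<lambda>b i. mscale (A b i) (munit b i)"
    have e: "?e b i \<in> msquare n" if "b < n" "i < n" for b i
      using that by (intro fm.subspace_scale[OF subspace_msquare] munit_msquare)
    have "\<pi> A = \<pi> (\<Sum>i<n. \<Sum>b<n. ?e b i)"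
      using msquare_expand[OF that(1)] by simp
    also have "\<dots> = (\<Sum>i<n. \<pi> (\<Sum>b<n. ?e b i))"
      using e by (intro \<pi>_sum fm.subspace_sum[OF subspace_msquare]) auto
    also have "\<dots> = (\<Sum>i<n. \<Sum>b<n. \<pi> (?e b i))"
      using e by (intro sum.cong refl \<pi>_sum) auto
    also have "\<dots> = (\<Sum>i<n. \<Sum>b<n. mscale (A b i) (\<pi> (munit b i)))"
      by (intro sum.cong refl \<pi>_scale munit_msquare) auto
    finally have "\<pi> A a j = (\<Sum>i<n. \<Sum>b<n. mscale (A b i) (\<pi> (munit b i))) a j"
      by (simp only:)
    then show ?thesis
      using that by (simp add: sum_fun_apply mscale_def mmul_def P_def mult.commute)
  qed
  \<comment> \<open>As \<open>c\<close> commutes with all blocks, \<open>\<pi> c\<close> is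
    \<open>c\<close> times \<open>\<pi> (mone n)\<close>, and \<open>\<pi>\<close> fixes the
    identity because the span contains it. Hence \<open>c\<close> is in the range of
    \<open>\<pi>\<close>.\<close>
  have "\<pi> c = c"
  proof (intro ext)
    fix a j
    have \<pi>c: "\<pi> c \<in> msquare n" using \<pi>(1)[OF c(1)] Bn by blast
    show "\<pi> c a j = c a j"
    proof (cases "a < n \<and> j < n")
      case True
      then have "\<pi> c a j = (\<Sum>i<n. mmul n (P i j) c a i)" using \<pi>_P c(1) by blast
      also have "\<dots> = (\<Sum>i<n. mmul n c (P i j) a i)" using c(2) P_comm True by simp
      also have "\<dots> = (\<Sum>i<n. \<Sum>l<n. c a l * P i j l i)" by (simp add: mmul_def)
      also have "\<dots> = (\<Sum>l<n. \<Sum>i<n. c a l * P i j l i)" by (rule sum.swap)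
      also have "\<dots> = (\<Sum>l<n. c a l * (\<Sum>i<n. mmul n (P i j) (mone n) l i))"
      proof -
        have "P i j \<in> msquare n" for i j by (simp add: P_def msquare_def)
        then show ?thesis by (simp add: mmul_mone(2) sum_distrib_left)
      qed
      also have "\<dots> = (\<Sum>l<n. c a l * \<pi> (mone n) l j)"
        using \<pi>_P[OF mone_msquare] True by simp
      also have "\<dots> = mmul n c (mone n) a j" using \<pi>_id[OF B1] by (simp add: mmul_def)
      finally show ?thesis using mmul_mone(2)[OF c(1)] by simp
    next
      case False
      then show ?thesis using msquare_eq_0[OF \<pi>c] msquare_eq_0[OF c(1)] by metis
    qed
  qed
  then show ?thesis using \<pi>(1)[OF c(1)] unfolding B_def by simp
qed

section \<open>Spanning representations\<close>

locale matrix_rep = group G for G (structure) +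
  fixes n :: nat and R :: "'a \<Rightarrow> nat \<Rightarrow> nat \<Rightarrow> 'k::field"
  assumes R_msquare: "g \<in> carrier G \<Longrightarrow> R g \<in> msquare n"
    and R_one: "R \<one> = mone n"
    and R_mult: "g \<in> carrier G \<Longrightarrow> h \<in> carrier G \<Longrightarrow> R (g \<otimes> h) = mmul n (R g) (R h)"
begin

lemma R_inv: "g \<in> carrier G \<Longrightarrow> mmul n (R g) (R (inv g)) = mone n"
  "g \<in> carrier G \<Longrightarrow> mmul n (R (inv g)) (R g) = mone n"
  using R_mult[of g "inv g"] R_mult[of "inv g" g] by (simp_all add: R_one)

lemma R_inv_cancel:
  assumes "g \<in> carrier G" "A \<in> msquare n"
  shows "mmul n (R g) (mmul n (R (inv g)) A) = A" "mmul n (R (inv g)) (mmul n (R g) A) = A"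
    "mmul n (mmul n A (R g)) (R (inv g)) = A" "mmul n (mmul n A (R (inv g))) (R g) = A"
  using R_inv assms mmul_mone by (metis mmul_assoc)+

end

locale spanning_matrix_rep = matrix_rep G n R
  for G (structure) and n :: nat and R :: "'a \<Rightarrow> nat \<Rightarrow> nat \<Rightarrow> 'k::field" +
  assumes spanning: "msquare n \<subseteq> fm.span (R ` carrier G)"
    and n_pos: "0 < n"
begin

text \<open>Since \<open>R\<close> spans, stability under the group on both sides is stability under
  all matrices on both sides. This is the form in which irreducibility is used below.\<close>

lemma bimodule_msquare:
  assumes J: "fm.subspace J" "J \<subseteq> msquare n" "J \<noteq> {0}"
    and JR: "\<And>g A. g \<in> carrier G \<Longrightarrow> A \<in> J \<Longrightarrow> mmul n (R g) A \<in> J \<and> mmul n A (R g) \<in> J"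
  shows "J = msquare n"
proof (rule two_sided_ideal_msquare[OF J])
  fix A B assume A: "A \<in> J" and B: "B \<in> (msquare n :: (nat \<Rightarrow> nat \<Rightarrow> 'k) set)"
  have "fm.span (R ` carrier G) \<subseteq> {B. mmul n B A \<in> J}"
    using JR A by (intro fm.span_minimal fmp.linear_subspace_linear_preimage[OF linear_mmul_right] J(1)) auto
  moreover have "fm.span (R ` carrier G) \<subseteq> {B. mmul n A B \<in> J}"
    using JR A by (intro fm.span_minimal fmp.linear_subspace_linear_preimage[OF linear_mmul_left] J(1)) auto
  ultimately show "mmul n B A \<in> J \<and> mmul n A B \<in> J" using spanning B by blast
qed

text \<open>Clifford's argument: the two-sided translates of a minimal \<open>S\<close>-stable subspace span everything.\<close>

lemma clifford_complement:
  assumes S: "S \<subseteq> msquare n"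
    and conj: "\<And>g s. g \<in> carrier G \<Longrightarrow> s \<in> S \<Longrightarrow> mmul n (R g) (mmul n s (R (inv g))) \<in> S"
    and A: "fm.stable (mmul n ` S) A"
  shows "\<exists>U. fm.stable (mmul n ` S) U \<and> A \<inter> U = {0} \<and> msquare n \<subseteq> {x + u |x u. x \<in> A \<and> u \<in> U}"
proof -
  let ?T = "mmul n ` S"
  have "fm.stable ?T (msquare n)"
    using S mmul_msquare subspace_msquare by (auto simp: fm.stable_def)
  moreover have "msquare n \<noteq> ({0} :: (nat \<Rightarrow> nat \<Rightarrow> 'k) set)"
  proof
    assume "msquare n = ({0} :: (nat \<Rightarrow> nat \<Rightarrow> 'k) set)"
    then have "mone n = (0 :: nat \<Rightarrow> nat \<Rightarrow> 'k)" using mone_msquare by blast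
    then have "mone n 0 0 = (0 :: 'k)" by simp
    then show False using n_pos by (simp add: mone_def)
  qed
  ultimately obtain S0 where S0: "S0 \<subseteq> msquare n" "S0 \<noteq> {0}" "fm.simple_stable ?T S0"
    using fm.exists_simple_stable[OF _ _ msquare_span_munit] by (metis finite_SigmaI finite_imageI finite_lessThan)
  \<comment> \<open>Right multiplication by \<open>R h\<close> commutes with the left action of
    \<open>S\<close>, and left multiplication by \<open>R g\<close> merely conjugates
    \<open>S\<close> into itself, so \<open>\<phi> g h\<close> carries stable subspaces to stable
    ones and simple ones to simple ones.\<close>
  define \<phi> where "\<phi> g h C = mmul n (R g) (mmul n C (R h))" for g h C
  have \<phi>_lin: "Vector_Spaces.linear mscale mscale (\<phi> g h)" for g h
    unfolding \<phi>_def by (rule linear_mmul_both)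
  have \<phi>_n: "\<phi> g h C \<in> msquare n" if "g \<in> carrier G" "h \<in> carrier G" "C \<in> msquare n" for g h C
    unfolding \<phi>_def using that by (intro mmul_msquare R_msquare)
  have \<phi>_inv: "\<phi> g h (\<phi> (inv g) (inv h) C) = C" "\<phi> (inv g) (inv h) (\<phi> g h C) = C"
    if "g \<in> carrier G" "h \<in> carrier G" "C \<in> msquare n" for g h C
  proof -
    have "\<phi> g h (\<phi> (inv g) (inv h) C)
        = mmul n (R g) (mmul n (R (inv g)) (mmul n (mmul n C (R (inv h))) (R h)))"
      by (simp add: \<phi>_def mmul_assoc)
    then show "\<phi> g h (\<phi> (inv g) (inv h) C) = C" using that by (simp add: R_inv_cancel)
    have "\<phi> (inv g) (inv h) (\<phi> g h C)
        = mmul n (R (inv g)) (mmul n (R g) (mmul n (mmul n C (R h)) (R (inv h))))"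
      by (simp add: \<phi>_def mmul_assoc)
    then show "\<phi> (inv g) (inv h) (\<phi> g h C) = C" using that by (simp add: R_inv_cancel)
  qed
  have \<phi>_stable: "fm.stable ?T (\<phi> g h ` C)"
    if "g \<in> carrier G" "h \<in> carrier G" "C \<subseteq> msquare n" "fm.stable ?T C" for g h C
    unfolding fm.stable_def
  proof (intro conjI ballI)
    show "fm.subspace (\<phi> g h ` C)"
      using that(4) by (intro fmp.linear_subspace_image[OF \<phi>_lin]) (simp add: fm.stable_def)
    fix t w assume "t \<in> ?T" "w \<in> \<phi> g h ` C"
    then obtain s x where s: "s \<in> S" "t = mmul n s" and x: "x \<in> C" "w = \<phi> g h x" by blast
    let ?s = "mmul n (R (inv g)) (mmul n s (R g))"
    have "?s \<in> S" using conj[of "inv g" s] that(1) s(1) by simp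
    then have sx: "mmul n ?s x \<in> C" using that(4) x(1) by (auto simp: fm.stable_def)
    have "\<phi> g h (mmul n ?s x) = mmul n (R g) (mmul n (R (inv g)) (mmul n s (mmul n (R g) (mmul n x (R h)))))"
      by (simp add: \<phi>_def mmul_assoc)
    also have "\<dots> = mmul n s (mmul n (R g) (mmul n x (R h)))"
      using that s(1) x(1) S by (intro R_inv_cancel(1) mmul_msquare R_msquare) auto
    also have "\<dots> = t w" by (simp add: \<phi>_def s(2) x(2))
    finally show "t w \<in> \<phi> g h ` C" using sx by (metis image_eqI)
  qed
  let ?F = "(\<lambda>(g, h). \<phi> g h ` S0) ` (carrier G \<times> carrier G)"
  have simple: "fm.simple_stable ?T (\<phi> g h ` S0)" if gh: "g \<in> carrier G" "h \<in> carrier G" for g h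
  proof -
    define B where "B = \<phi> g h ` S0"
    note B = B_def
    have st: "fm.stable ?T S0" and min: "\<And>C. fm.stable ?T C \<Longrightarrow> C \<subseteq> S0 \<Longrightarrow> C = {0} \<or> C = S0"
      using S0(3) by (auto simp: fm.simple_stable_def)
    have "C = {0} \<or> C = B" if C: "fm.stable ?T C" "C \<subseteq> B" for C
    proof -
      have Xn: "C \<subseteq> msquare n" using C(2) B \<phi>_n gh S0(1) by blast
      let ?Y = "\<phi> (inv g) (inv h) ` C"
      have "?Y \<subseteq> \<phi> (inv g) (inv h) ` \<phi> g h ` S0" using C(2) B by blast
      also have "\<dots> \<subseteq> S0" using \<phi>_inv(2)[OF gh] S0(1) by force
      finally have "?Y \<subseteq> S0" .
      then have "?Y = {0} \<or> ?Y = S0" using min \<phi>_stable[of "inv g" "inv h" C] gh Xn C(1) by simp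
      moreover have "\<phi> g h ` ?Y = C"
        using \<phi>_inv(1)[OF gh] Xn by (auto simp: image_image subset_iff)
      moreover have "\<phi> g h 0 = 0" by (simp add: \<phi>_def)
      ultimately show ?thesis using B by (metis image_empty image_insert)
    qed
    then show ?thesis
      unfolding fm.simple_stable_def using \<phi>_stable[OF gh S0(1) st] by (simp add: B)
  qed
  have *: "\<exists>U. fm.stable ?T U \<and> A \<inter> U = {0} \<and> fm.span (\<Union>?F) \<subseteq> {x + u |x u. x \<in> A \<and> u \<in> U}"
  proof (rule fm.stable_complement[OF _ _ A])
    show "t (x + y) = t x + t y" if "t \<in> ?T" for t x y
      using that by (auto simp: mmul_add_right)
    show "fm.simple_stable ?T B" if "B \<in> ?F" for B
      using that simple by auto
  qed
  define V where "V = \<Union>?F"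
  have memV: "\<phi> a b x \<in> V" if "a \<in> carrier G" "b \<in> carrier G" "x \<in> S0" for a b x
    unfolding V_def by (rule UN_I[of "(a, b)"]) (use that in auto)
  have "fm.span (V) = msquare n"
  proof (rule bimodule_msquare)
    show "fm.subspace (fm.span (V))" by (rule fm.subspace_span)
    have "V \<subseteq> msquare n" using \<phi>_n S0(1) by (auto simp: V_def)
    then show "fm.span (V) \<subseteq> msquare n" using subspace_msquare by (rule fm.span_minimal)
    have "0 \<in> S0" using S0(3) fm.subspace_0 by (auto simp: fm.simple_stable_def fm.stable_def)
    then obtain x where x: "x \<in> S0" "x \<noteq> 0" using S0(2) by auto
    have "\<phi> \<one> \<one> x = x" using x S0(1) by (simp add: \<phi>_def R_one mmul_mone subset_iff)
    then have "x \<in> V" using memV[of \<one> \<one> x] x(1) by simp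
    then have "x \<in> fm.span (V)" by (rule fm.span_base)
    then show "fm.span (V) \<noteq> {0}" using x(2) by (metis singletonD)
    fix g C assume g: "g \<in> carrier G" and C: "C \<in> fm.span (V)"
    have base: "mmul n (R g) Y \<in> V \<and> mmul n Y (R g) \<in> V" if Y: "Y \<in> V" for Y
    proof -
      obtain a b x where ab: "a \<in> carrier G" "b \<in> carrier G" "x \<in> S0" "Y = \<phi> a b x" using Y by (auto simp: V_def)
      have "mmul n (R g) Y = \<phi> (g \<otimes> a) b x" "mmul n Y (R g) = \<phi> a (b \<otimes> g) x"
        using ab g by (simp_all add: \<phi>_def R_mult mmul_assoc)
      then show ?thesis using memV ab(1-3) g by simp
    qed
    have "fm.span (V) \<subseteq> {Y. mmul n (R g) Y \<in> fm.span (V)}"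
      using base fm.span_base
      by (intro fm.span_minimal fmp.linear_subspace_linear_preimage[OF linear_mmul_left] fm.subspace_span) blast
    moreover have "fm.span (V) \<subseteq> {Y. mmul n Y (R g) \<in> fm.span (V)}"
      using base fm.span_base
      by (intro fm.span_minimal fmp.linear_subspace_linear_preimage[OF linear_mmul_right] fm.subspace_span) blast
    ultimately show "mmul n (R g) C \<in> fm.span (V) \<and> mmul n C (R g) \<in> fm.span (V)"
      using C by blast
  qed
  with * show ?thesis by (simp add: V_def)
qed

section \<open>Commutants of normal subgroups: conjugation and the trace form\<close>

lemma subspace_commutant: "fm.subspace (commutant n S)"
  using subspace_msquare
  by (auto simp: fm.subspace_def commutant_def mmul_add_left mmul_add_right mmul_scale_left mmul_scale_right)

lemma commutant_mmul: "A \<in> commutant n S \<Longrightarrow> B \<in> commutant n S \<Longrightarrow> mmul n A B \<in> commutant n S"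
  by (simp add: commutant_def mmul_msquare) (metis mmul_assoc)

lemma commutant_conj:
  assumes N: "N \<lhd> G" and g: "g \<in> carrier G" and A: "A \<in> commutant n (R ` N)"
  shows "mmul n (R g) (mmul n A (R (inv g))) \<in> commutant n (R ` N)"
proof -
  interpret N: normal N G by (rule N)
  have An: "A \<in> msquare n" using A by (simp add: commutant_def)
  have "mmul n (mmul n (R g) (mmul n A (R (inv g)))) (R y) =
      mmul n (R y) (mmul n (R g) (mmul n A (R (inv g))))" if y: "y \<in> N" for y
  proof -
    have yG: "y \<in> carrier G" using y N.subset by blast
    define z where "z = inv g \<otimes> y \<otimes> g"
    have z: "z \<in> N" "z \<in> carrier G" unfolding z_def using N.inv_op_closed1[OF g y] N.subset by auto
    have "inv g \<otimes> y = z \<otimes> inv g" "y \<otimes> g = g \<otimes> z"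
      using g yG by (simp_all add: z_def m_assoc) (simp add: m_assoc[symmetric])
    then have 1: "mmul n (R (inv g)) (R y) = mmul n (R z) (R (inv g))"
      and 2: "mmul n (R y) (R g) = mmul n (R g) (R z)"
      using g yG z by (metis R_mult inv_closed)+
    have "mmul n (mmul n (R g) (mmul n A (R (inv g)))) (R y)
        = mmul n (R g) (mmul n A (mmul n (R z) (R (inv g))))" by (simp add: mmul_assoc 1)
    also have "\<dots> = mmul n (R g) (mmul n (mmul n A (R z)) (R (inv g)))" by (simp add: mmul_assoc)
    also have "mmul n A (R z) = mmul n (R z) A" using A z by (auto simp: commutant_def)
    also have "mmul n (R g) (mmul n (mmul n (R z) A) (R (inv g)))
        = mmul n (mmul n (R g) (R z)) (mmul n A (R (inv g)))" by (simp add: mmul_assoc)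
    finally show ?thesis by (simp add: 2[symmetric] mmul_assoc)
  qed
  then show ?thesis using An g by (auto simp: commutant_def intro!: mmul_msquare R_msquare)
qed

text \<open>The radical of the trace form on the commutant is a \<open>G\<close>-stable ideal. By Clifford's argument it
  has a right identity; if the radical is non-zero, that identity is \<open>1\<close>, whose trace is \<open>n \<noteq> 0\<close>.\<close>

lemma commutant_trace_nondegenerate:
  assumes N: "N \<lhd> G" and nz: "of_nat n \<noteq> (0 :: 'k)"
    and e: "e \<in> commutant n (R ` N)" "\<And>e'. e' \<in> commutant n (R ` N) \<Longrightarrow> mtrace n (mmul n e e') = 0"
  shows "e = 0"
proof (rule ccontr)
  assume e0: "e \<noteq> 0"
  define E where "E = commutant n (R ` N)"
  define Q where "Q = {r \<in> E. \<forall>e'\<in>E. mtrace n (mmul n r e') = 0}"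
  have En: "E \<subseteq> msquare n" by (auto simp: E_def commutant_def)
  have Esub: "fm.subspace E" unfolding E_def by (rule subspace_commutant)
  have Emul: "mmul n a b \<in> E" if "a \<in> E" "b \<in> E" for a b
    using commutant_mmul that by (simp add: E_def)
  have Econj: "mmul n (R g) (mmul n a (R (inv g))) \<in> E" if "g \<in> carrier G" "a \<in> E" for a g
    using commutant_conj N that by (simp add: E_def)
  have Qsub: "fm.subspace Q"
    using Esub by (auto simp: fm.subspace_def Q_def mmul_add_left mtrace_add mmul_scale_left mtrace_scale mtrace_zero)
  have Qmul: "mmul n a r \<in> Q" if a: "a \<in> E" and r: "r \<in> Q" for a r
  proof -
    have "mtrace n (mmul n (mmul n a r) e') = 0" if "e' \<in> E" for e'
    proof -
      have "mtrace n (mmul n (mmul n a r) e') = mtrace n (mmul n r (mmul n e' a))"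
        using mtrace_mmul_commute[of n a "mmul n r e'"] by (simp add: mmul_assoc)
      then show ?thesis using r Emul a that by (simp add: Q_def)
    qed
    then show ?thesis using Emul a r by (simp add: Q_def)
  qed
  have Qconj: "mmul n (R g) (mmul n r (R (inv g))) \<in> Q" if g: "g \<in> carrier G" and r: "r \<in> Q" for g r
  proof -
    have "mtrace n (mmul n (mmul n (R g) (mmul n r (R (inv g)))) e') = 0" if e': "e' \<in> E" for e'
    proof -
      have "mtrace n (mmul n (mmul n (R g) (mmul n r (R (inv g)))) e')
          = mtrace n (mmul n r (mmul n (R (inv g)) (mmul n e' (R g))))"
        using mtrace_mmul_commute[of n "R g" "mmul n (mmul n r (R (inv g))) e'"] by (simp add: mmul_assoc)
      moreover have "mmul n (R (inv g)) (mmul n e' (R g)) \<in> E" using Econj[of "inv g" e'] g e' by simp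
      ultimately show ?thesis using r by (simp add: Q_def)
    qed
    then show ?thesis using Econj g r by (simp add: Q_def)
  qed
  have eQ: "e \<in> Q" using e by (simp add: Q_def E_def)
  have "fm.stable (mmul n ` E) Q" using Qsub Qmul by (auto simp: fm.stable_def)
  then obtain U where U: "fm.stable (mmul n ` E) U" "Q \<inter> U = {0}"
    "msquare n \<subseteq> {x + u |x u. x \<in> Q \<and> u \<in> U}"
    using clifford_complement[OF En Econj] by blast
  \<comment> \<open>\<open>f\<close> is the component of the identity in \<open>Q\<close>. For
    \<open>r\<close> in \<open>Q\<close>, splitting \<open>r\<close> along \<open>f + u\<close> puts
    \<open>r - r f\<close> into both \<open>Q\<close> and \<open>U\<close>, so \<open>f\<close> is a
    right identity of \<open>Q\<close>.\<close>
  obtain f u where fu: "mone n = f + u" "f \<in> Q" "u \<in> U" using U(3) mone_msquare by blast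
  have Qf: "mmul n r f = r" if r: "r \<in> Q" for r
  proof -
    have rE: "r \<in> E" using r by (simp add: Q_def)
    have "r = mmul n r f + mmul n r u"
      using mmul_mone(2)[of r n] rE En fu(1) by (metis mmul_add_right subsetD)
    then have "mmul n r u = r - mmul n r f" by (metis add_diff_cancel_left')
    moreover have "r - mmul n r f \<in> Q"
      using fm.subspace_diff[OF Qsub r Qmul[OF rE fu(2)]] .
    moreover have "mmul n r u \<in> U" using U(1) rE fu(3) by (auto simp: fm.stable_def)
    ultimately have "r - mmul n r f \<in> Q \<inter> U" by simp
    then show ?thesis unfolding U(2) by simp
  qed
  \<comment> \<open>\<open>Q\<close> lives inside \<open>E\<close>, so it is spread out by left
    multiplication with all matrices. The result is also stable on the right: \<open>R g\<close> can
    be moved to the left of \<open>r\<close> at the cost of conjugating \<open>r\<close>, and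
    \<open>Q\<close> is stable under conjugation.\<close>
  define J where "J = fm.span {mmul n A r |A r. A \<in> msquare n \<and> r \<in> Q}"
  have Qn: "Q \<subseteq> msquare n" using En by (auto simp: Q_def)
  have "J = msquare n"
  proof (rule bimodule_msquare)
    show "fm.subspace J" unfolding J_def by (rule fm.subspace_span)
    show "J \<subseteq> msquare n"
      unfolding J_def using mmul_msquare Qn by (intro fm.span_minimal subspace_msquare) blast
    have "mmul n (mone n) e \<in> J" unfolding J_def using mone_msquare eQ by (blast intro: fm.span_base)
    then have "e \<in> J" using mmul_mone(1)[of e n] eQ Qn by (simp add: subset_iff)
    then show "J \<noteq> {0}" using e0 by blast
    fix g C assume g: "g \<in> carrier G" and C: "C \<in> J"
    have "mmul n (R g) (mmul n A r) \<in> J \<and> mmul n (mmul n A r) (R g) \<in> J"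
      if A: "A \<in> msquare n" and r: "r \<in> Q" for A r
    proof -
      have rn: "r \<in> msquare n" using r Qn by blast
      have "mmul n (R g) (mmul n A r) = mmul n (mmul n (R g) A) r" by (simp add: mmul_assoc)
      moreover have "mmul n (R g) A \<in> msquare n" using R_msquare[OF g] A by (rule mmul_msquare)
      ultimately have 1: "mmul n (R g) (mmul n A r) \<in> J"
        unfolding J_def using r by (blast intro: fm.span_base)
      let ?r = "mmul n (R (inv g)) (mmul n r (R g))"
      have "mmul n (mmul n A (R g)) ?r = mmul n A (mmul n (R g) (mmul n (R (inv g)) (mmul n r (R g))))"
        by (simp add: mmul_assoc)
      also have "\<dots> = mmul n (mmul n A r) (R g)"
        using R_inv_cancel(1)[OF g mmul_msquare[OF rn R_msquare[OF g]]] by (simp add: mmul_assoc)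
      finally have "mmul n (mmul n A r) (R g) = mmul n (mmul n A (R g)) ?r" ..
      moreover have "?r \<in> Q" using Qconj[of "inv g" r] g r by simp
      moreover have "mmul n A (R g) \<in> msquare n" using A R_msquare[OF g] by (rule mmul_msquare)
      ultimately have "mmul n (mmul n A r) (R g) \<in> J"
        unfolding J_def by (blast intro: fm.span_base)
      with 1 show ?thesis by blast
    qed
    then have "J \<subseteq> {C. mmul n (R g) C \<in> J}" "J \<subseteq> {C. mmul n C (R g) \<in> J}"
      unfolding J_def
      by (intro fm.span_minimal fmp.linear_subspace_linear_preimage[OF linear_mmul_left]
          fmp.linear_subspace_linear_preimage[OF linear_mmul_right] fm.subspace_span; blast)+
    then show "mmul n (R g) C \<in> J \<and> mmul n C (R g) \<in> J" using C by blast
  qed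
  \<comment> \<open>Right multiplication by \<open>f\<close> fixes \<open>J\<close>, hence every
    matrix. Applied to the identity this gives \<open>f = mone n\<close>, which places the identity
    in the radical.\<close>
  have "J \<subseteq> {C. mmul n C f - C \<in> {0}}"
    unfolding J_def
  proof (rule fm.span_minimal)
    show "fm.subspace {C. mmul n C f - C \<in> {0}}"
      by (auto simp: fm.subspace_def mmul_add_left mmul_scale_left)
  qed (use Qf in \<open>auto simp: mmul_assoc\<close>)
  then have "mmul n (mone n) f = mone n" using mone_msquare \<open>J = msquare n\<close> by auto
  moreover have "mmul n (mone n) f = f" using mmul_mone(1)[of f n] fu(2) Qn by blast
  ultimately have "mone n \<in> Q" using fu(2) by simp
  then have "mtrace n (mmul n (mone n) (mone n)) = (0 :: 'k)" by (simp add: Q_def)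
  then show False using nz by (simp add: mmul_mone mone_msquare mtrace_mone)
qed

lemma commutant_iff_conj:
  assumes "H \<subseteq> carrier G" "A \<in> msquare n"
  shows "A \<in> commutant n (R ` H) \<longleftrightarrow> (\<forall>y\<in>H. mmul n (R y) (mmul n A (R (inv y))) = A)"
proof -
  have "mmul n A (R y) = mmul n (R y) A \<longleftrightarrow> mmul n (R y) (mmul n A (R (inv y))) = A"
    if "y \<in> H" for y
    using that assms R_inv_cancel[of y A] by (metis mmul_assoc subsetD)
  then show ?thesis using assms(2) by (auto simp: commutant_def)
qed

text \<open>Conjugation by \<open>y \<in> N\<close> acts on the commutant \<open>D\<close> of \<open>M\<close> with \<open>p\<close>-th power \<open>1\<close>, and these actions
  commute, so if \<open>D\<close> were larger than the commutant \<open>E\<close> of \<open>N\<close>, some \<open>d \<in> D - E\<close> would be fixed modulo \<open>E\<close>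
  by all of \<open>N\<close>. But \<open>y d y\<inverse> - d\<close> is orthogonal to \<open>E\<close> for the trace form, so it vanishes as soon as it
  lies in \<open>E\<close>.\<close>

lemma commutant_elementary_abelian_step:
  assumes fin: "finite (carrier G)" and p: "Factorial_Ring.prime p" "CHAR('k) = p" "\<not> p dvd n"
    and N: "N \<lhd> G" and M: "M \<lhd> G" "M \<subseteq> N"
    and pow: "\<And>y. y \<in> N \<Longrightarrow> y [^] p \<in> M"
    and comm: "\<And>y z. y \<in> N \<Longrightarrow> z \<in> N \<Longrightarrow> y \<otimes> z \<otimes> inv y \<otimes> inv z \<in> M"
  shows "commutant n (R ` M) \<subseteq> commutant n (R ` N)"
proof (rule ccontr)
  assume neg: "\<not> ?thesis"
  interpret N: normal N G by (rule N)
  interpret M: normal M G by (rule M(1))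
  define D where "D = commutant n (R ` M)"
  define E where "E = commutant n (R ` N)"
  define c where "c y d = mmul n (R y) (mmul n d (R (inv y)))" for y d
  define T where "T y = (\<lambda>d. c y d - d)" for y
  have NG: "y \<in> carrier G" if "y \<in> N" for y using that N.subset by blast
  have MG: "y \<in> carrier G" if "y \<in> M" for y using that M.subset by blast
  have c_lin: "Vector_Spaces.linear mscale mscale (c y)" for y
    unfolding c_def by (rule linear_mmul_both)
  have nz: "of_nat n \<noteq> (0 :: 'k)" using p by (simp add: of_nat_eq_0_iff_char_dvd)
  have Dn: "D \<subseteq> msquare n" by (auto simp: D_def commutant_def)
  have Dsub: "fm.subspace D" and Esub: "fm.subspace E"
    unfolding D_def E_def by (rule subspace_commutant)+
  have cD: "c y d \<in> D" if "y \<in> N" "d \<in> D" for y d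
    using commutant_conj[OF M(1) NG] that unfolding D_def c_def by blast
  have TD: "T y d \<in> D" if "y \<in> N" "d \<in> D" for y d
    unfolding T_def using cD that by (intro fm.subspace_diff[OF Dsub])
  have c_mult: "c (y \<otimes> z) d = c y (c z d)" if "y \<in> carrier G" "z \<in> carrier G" for y z d
    using that by (simp add: c_def R_mult inv_mult_group mmul_assoc)
  have cM: "c y d = d" if "y \<in> M" "d \<in> D" for y d
    using commutant_iff_conj[OF M.subset] that Dn unfolding D_def c_def by blast
  have c_comm: "c y (c z d) = c z (c y d)" if y: "y \<in> N" and z: "z \<in> N" and d: "d \<in> D" for y z d
  proof -
    \<comment> \<open>The commutator of the two inverses is the right-hand factor by which
      \<open>y \<otimes> z\<close> differs from \<open>z \<otimes> y\<close>; as an element of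
      \<open>M\<close> it acts trivially on \<open>D\<close>.\<close>
    let ?m = "inv y \<otimes> inv z \<otimes> inv (inv y) \<otimes> inv (inv z)"
    have m: "?m \<in> M" using y z by (intro comm) auto
    have "y \<otimes> z = z \<otimes> y \<otimes> ?m"
      using NG[OF y] NG[OF z] by (simp add: m_assoc) (simp add: m_assoc[symmetric])
    then have "c y (c z d) = c (z \<otimes> y \<otimes> ?m) d"
      using NG[OF y] NG[OF z] by (metis c_mult)
    also have "\<dots> = c z (c y (c ?m d))"
      using NG[OF y] NG[OF z] MG[OF m] by (simp only: c_mult m_closed)
    finally show ?thesis using cM[OF m d] by simp
  qed
  have T_comm: "T y (T z d) = T z (T y d)" if "y \<in> N" "z \<in> N" "d \<in> D" for y z d
    unfolding T_def using c_comm[OF that] by (simp add: fmp.linear_diff[OF c_lin])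
  have T0: "T y 0 = 0" for y unfolding T_def by (simp add: fmp.linear_0[OF c_lin])
  have Tpow_D: "(T y ^^ k) d \<in> D" if "y \<in> N" "d \<in> D" for y k d
    by (induction k) (use that TD in auto)
  have Tpow_comm: "T z ((T y ^^ k) d) = (T y ^^ k) (T z d)" if "y \<in> N" "z \<in> N" "d \<in> D" for y z k d
  proof (induction k)
    case (Suc k)
    then show ?case using T_comm[of z y "(T y ^^ k) d"] that Tpow_D by simp
  qed simp
  have Tpow0: "(T y ^^ k) 0 = 0" for y k by (induction k) (simp_all only: funpow.simps id_apply o_apply T0)
  \<comment> \<open>\<open>T y\<close> is conjugation minus 1, so in characteristic \<open>p\<close>
    its \<open>p\<close>-th power is conjugation by \<open>y [^] p\<close> minus 1, and
    \<open>y [^] p\<close> lies in \<open>M\<close>.\<close>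
  have Tp: "(T y ^^ p) d = 0" if y: "y \<in> N" and d: "d \<in> D" for y d
  proof -
    have "(c y ^^ k) d = c (y [^] k) d" for k
    proof (induction k)
      case 0
      have "c \<one> d = d" using d Dn by (simp add: c_def R_one mmul_mone subset_iff)
      then show ?case by simp
    next
      case (Suc k)
      have "y [^] Suc k = y \<otimes> y [^] k" using NG[OF y] by (rule nat_pow_Suc2)
      then show ?case using Suc NG[OF y] by (simp add: c_mult del: nat_pow_Suc)
    qed
    then have "(c y ^^ p) d = d" using cM[OF pow[OF y] d] by simp
    then show ?thesis
      using fm.funpow_char[OF c_lin p(1,2), of y d] by (simp add: T_def)
  qed
  have T_E: "T y d = 0" if y: "y \<in> N" and d: "d \<in> D" and TE: "T y d \<in> E" for y d
  proof (rule commutant_trace_nondegenerate[OF N nz])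
    show "T y d \<in> commutant n (R ` N)" using TE by (simp add: E_def)
    fix e assume e: "e \<in> commutant n (R ` N)"
    \<comment> \<open>Cyclicity of the trace moves the conjugation from \<open>d\<close> to
      \<open>e\<close>, and \<open>e\<close> commutes with \<open>R y\<close>.\<close>
    have "mtrace n (mmul n (c y d) e) = mtrace n (mmul n d (mmul n (R (inv y)) (mmul n e (R y))))"
      using mtrace_mmul_commute[of n "R y" "mmul n (mmul n d (R (inv y))) e"]
      by (simp add: c_def mmul_assoc)
    also have "mmul n e (R y) = mmul n (R y) e" using e y by (auto simp: commutant_def)
    also have "mmul n (R (inv y)) (mmul n (R y) e) = e"
      using R_inv_cancel(2)[OF NG[OF y]] e by (simp add: commutant_def)
    finally show "mtrace n (mmul n (T y d) e) = 0"
      by (simp add: T_def mmul_diff_left mtrace_diff)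
  qed
  have fixed: "\<exists>d'\<in>D - E. \<forall>y\<in>F. T y d' = 0" if "finite F" "F \<subseteq> N" "d \<in> D - E" for F d
    using that
  proof (induction F rule: finite_induct)
    case empty
    then show ?case by blast
  next
    case (insert y F)
    then have "\<exists>d'\<in>D - E. \<forall>y\<in>F. T y d' = 0" by blast
    then obtain d' where d': "d' \<in> D" "d' \<notin> E" "\<And>z. z \<in> F \<Longrightarrow> T z d' = 0" by blast
    have y: "y \<in> N" using insert.prems by simp
    \<comment> \<open>Apply \<open>T y\<close> until just before \<open>E\<close> is reached: the
      last iterate outside \<open>E\<close> is sent into \<open>E\<close>, hence to 0 by
      \<open>T_E\<close>. It is still killed by the operators treated earlier, since they commute
      with \<open>T y\<close>.\<close>
    let ?P = "\<lambda>k. (T y ^^ k) d' \<in> E"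
    have "?P p" using Tp[OF y d'(1)] fm.subspace_0[OF Esub] by simp
    then obtain k where k: "?P k" "\<And>j. j < k \<Longrightarrow> \<not> ?P j"
      using exists_least_iff[of ?P] by blast
    have "k \<noteq> 0" using k(1) d'(2) by (cases k) auto
    then obtain j where j: "k = Suc j" by (cases k) auto
    let ?d = "(T y ^^ j) d'"
    have dD: "?d \<in> D" using Tpow_D y d'(1) by blast
    have "?d \<notin> E" using k(2) j by simp
    moreover have "T y ?d = 0" using T_E[OF y dD] k(1) j by simp
    moreover have "T z ?d = 0" if "z \<in> F" for z
      using Tpow_comm[OF y _ d'(1), of z j] that insert.prems d'(3) Tpow0 by auto
    ultimately show ?case using dD by blast
  qed
  obtain d where "d \<in> D - E" using neg by (auto simp: D_def E_def)
  moreover have "finite N" using fin N.subset finite_subset by blast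
  ultimately obtain d' where d': "d' \<in> D - E" "\<And>y. y \<in> N \<Longrightarrow> T y d' = 0"
    using fixed[of N d] by blast
  then have "\<forall>y\<in>N. c y d' = d'" by (simp add: T_def)
  then have "d' \<in> E"
    using commutant_iff_conj[OF N.subset] d'(1) Dn unfolding E_def c_def by blast
  then show False using d'(1) by blast
qed

text \<open>The double commutant theorem requires a stable complement of the span. Clifford's
  argument supplies one, applied to the span itself as a stable subspace of the matrix
  algebra.\<close>

lemma span_elementary_abelian_step:
  assumes fin: "finite (carrier G)" and p: "Factorial_Ring.prime p" "CHAR('k) = p" "\<not> p dvd n"
    and N: "N \<lhd> G" and M: "M \<lhd> G" "M \<subseteq> N"
    and pow: "\<And>y. y \<in> N \<Longrightarrow> y [^] p \<in> M"
    and comm: "\<And>y z. y \<in> N \<Longrightarrow> z \<in> N \<Longrightarrow> y \<otimes> z \<otimes> inv y \<otimes> inv z \<in> M"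
    and y: "y \<in> N"
  shows "R y \<in> fm.span (R ` M)"
proof -
  interpret N: normal N G by (rule N)
  interpret M: normal M G by (rule M(1))
  have yG: "y \<in> carrier G" using y N.subset by blast
  have MG: "m \<in> carrier G" if "m \<in> M" for m using that M.subset by blast
  have S: "R ` M \<subseteq> msquare n" using R_msquare MG by blast
  have S1: "mone n \<in> R ` M" using R_one M.one_closed by (metis image_eqI)
  have Smul: "mmul n s t \<in> R ` M" if "s \<in> R ` M" "t \<in> R ` M" for s t
    using that MG by (auto simp: R_mult[symmetric])
  have conj: "mmul n (R g) (mmul n s (R (inv g))) \<in> R ` M" if g: "g \<in> carrier G" and s: "s \<in> R ` M" for g s
  proof -
    obtain m where m: "m \<in> M" "s = R m" using s by blast
    have "mmul n (R g) (mmul n s (R (inv g))) = R (g \<otimes> m \<otimes> inv g)"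
      using g m MG by (simp add: R_mult mmul_assoc)
    then show ?thesis using M.inv_op_closed2[OF g m(1)] by simp
  qed
  obtain U where U: "fm.stable (mmul n ` (R ` M)) U" "fm.span (R ` M) \<inter> U = {0}"
    "msquare n \<subseteq> {x + u |x u. x \<in> fm.span (R ` M) \<and> u \<in> U}"
    using clifford_complement[OF S conj stable_span[OF Smul]] by blast
  show ?thesis
  proof (rule double_commutant[OF S S1 Smul U R_msquare[OF yG]])
    fix A assume "A \<in> commutant n (R ` M)"
    then have "A \<in> commutant n (R ` N)"
      using commutant_elementary_abelian_step[OF fin p N M pow comm] by blast
    then show "mmul n (R y) A = mmul n A (R y)" using y by (auto simp: commutant_def)
  qed
qed

text \<open>The factor \<open>x\<close> belongs to the induction statement because the two cases
  treat it differently: in the case of order prime to \<open>p\<close> it is replaced by another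
  element \<open>x'\<close>, while in the elementary abelian case it stays and only
  \<open>R y\<close> is rewritten as a combination over the smaller subgroup.\<close>

lemma normal_p_regular_span:
  assumes fin: "finite (carrier G)" and p: "Factorial_Ring.prime p" "CHAR('k) = p" "\<not> p dvd n"
    and ch: "p_chain G p H m"
    and N: "N \<lhd> G" and x: "x \<in> p_regular G p" and y: "y \<in> N"
  shows "R (x \<otimes> y) \<in> fm.span (R ` p_regular G p)"
  using N x y
proof (induction "card N" arbitrary: N x y rule: less_induct)
  case less
  interpret N: normal N G by (rule less.prems(1))
  let ?A = "fm.span (R ` p_regular G p)"
  have finN: "finite N" using fin N.subset finite_subset by blast
  have xG: "x \<in> carrier G" using less.prems by (simp add: p_regular_def)
  have NG: "y \<in> carrier G" if "y \<in> N" for y using that N.subset by blast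
  show ?case
  proof (cases "N = {\<one>}")
    case True
    then have "x \<otimes> y = x" using less.prems xG by simp
    then show ?thesis using less.prems(2) by (simp add: fm.span_base)
  next
    case False
    have Hm: "N \<subseteq> H m" and H0: "\<not> N \<subseteq> H 0"
      using ch N.subset False N.one_closed by (auto simp: p_chain_def)
    define k where "k = (LEAST k. N \<subseteq> H k)"
    have Nk: "N \<subseteq> H k" unfolding k_def using Hm by (rule LeastI)
    have "k \<le> m" unfolding k_def using Hm by (rule Least_le)
    have "k \<noteq> 0" using Nk H0 by (cases k) auto
    then obtain i where i: "k = Suc i" by (cases k) auto
    have Ni: "\<not> N \<subseteq> H i" using not_less_Least[of i "\<lambda>k. N \<subseteq> H k"] i k_def by simp
    have Hi: "subgroup (H i) G" and
      alt: "(\<forall>y\<in>H (Suc i). y [^] p \<in> H i) \<and>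
       (\<forall>y\<in>H (Suc i). \<forall>z\<in>H (Suc i). y \<otimes> z \<otimes> inv y \<otimes> inv z \<in> H i)
       \<or> H (Suc i) \<inter> p_elements G p \<subseteq> H i"
      using ch i \<open>k \<le> m\<close> by (auto simp: p_chain_def)
    have IH: "R (x' \<otimes> w) \<in> ?A"
      if B: "B \<subseteq> N" "B \<subseteq> H i" "\<And>h g. h \<in> B \<Longrightarrow> g \<in> carrier G \<Longrightarrow> g \<otimes> h \<otimes> inv g \<in> B"
        and x': "x' \<in> p_regular G p" and w: "w \<in> generate G B" for B x' w
    proof -
      have BG: "B \<subseteq> carrier G" using B(1) N.subset by blast
      have "generate G B \<subseteq> N" using generate_subgroup_incl[OF B(1) N.subgroup_axioms] .
      moreover have "generate G B \<subseteq> H i" using generate_subgroup_incl[OF B(2) Hi] .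
      ultimately have "card (generate G B) < card N"
        using Ni finN by (metis psubsetI psubset_card_mono)
      then show ?thesis using less.hyps normal_generateI[OF BG B(3)] x' w by blast
    qed
    have conjN: "g \<otimes> h \<otimes> inv g \<in> N" if "h \<in> N" "g \<in> carrier G" for g h
      using N.inv_op_closed2 that by blast
    from alt show ?thesis
    proof
      assume st: "H (Suc i) \<inter> p_elements G p \<subseteq> H i"
      let ?B = "N \<inter> p_elements G p"
      obtain x' w where xw: "x' \<in> p_regular G p" "w \<in> ?B" "x \<otimes> y = x' \<otimes> w"
        using p_regular_mult_normal[OF fin p(1) less.prems] by blast
      have "R (x' \<otimes> w) \<in> ?A"
      proof (rule IH[OF _ _ _ xw(1)])
        show "?B \<subseteq> H i" using st Nk i by blast
        show "g \<otimes> h \<otimes> inv g \<in> ?B" if h: "h \<in> ?B" and g: "g \<in> carrier G" for h g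
        proof -
          obtain j where j: "h \<in> carrier G" "h [^] (p ^ j) = \<one>" using h by (auto simp: p_elements_def)
          then have "(g \<otimes> h \<otimes> inv g) [^] (p ^ j) = \<one>" using g by (simp add: conj_nat_pow)
          then show ?thesis using h g j(1) conjN[of h g] by (auto simp: p_elements_def)
        qed
        show "w \<in> generate G ?B" using xw(2) by (rule generate.incl)
      qed blast
      then show ?thesis using xw(3) by simp
    next
      assume st: "(\<forall>y\<in>H (Suc i). y [^] p \<in> H i) \<and>
       (\<forall>y\<in>H (Suc i). \<forall>z\<in>H (Suc i). y \<otimes> z \<otimes> inv y \<otimes> inv z \<in> H i)"
      let ?cm = "\<lambda>(y, z). y \<otimes> z \<otimes> inv y \<otimes> inv z"
      let ?B = "(\<lambda>y. y [^] p) ` N \<union> ?cm ` (N \<times> N)"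
      have BN: "?B \<subseteq> N" using subgroup_nat_pow_closed[OF N.subgroup_axioms] by auto
      have BH: "?B \<subseteq> H i" using st Nk i by auto
      have Bconj: "g \<otimes> h \<otimes> inv g \<in> ?B" if h: "h \<in> ?B" and g: "g \<in> carrier G" for h g
        using h
      proof
        assume "h \<in> (\<lambda>y. y [^] p) ` N"
        then obtain a where a: "a \<in> N" "h = a [^] p" by blast
        then have "g \<otimes> h \<otimes> inv g = (g \<otimes> a \<otimes> inv g) [^] p" using g NG by (simp add: conj_nat_pow)
        then show ?thesis using conjN[OF a(1) g] by blast
      next
        assume "h \<in> ?cm ` (N \<times> N)"
        then obtain a b where a: "a \<in> N" and b: "b \<in> N" and h: "h = a \<otimes> b \<otimes> inv a \<otimes> inv b" by auto
        have "g \<otimes> h \<otimes> inv g = ?cm (g \<otimes> a \<otimes> inv g, g \<otimes> b \<otimes> inv g)"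
          using g NG[OF a] NG[OF b] unfolding h by (simp add: conj_commutator)
        then have "g \<otimes> h \<otimes> inv g \<in> ?cm ` (N \<times> N)"
          by (rule image_eqI) (simp add: conjN a b g)
        then show ?thesis by (rule UnI2)
      qed
      have BG: "?B \<subseteq> carrier G" using BN N.subset by (rule subset_trans)
      let ?M = "generate G ?B"
      have M: "?M \<lhd> G" using normal_generateI[OF BG Bconj] .
      have "?M \<subseteq> N" using generate_subgroup_incl[OF BN N.subgroup_axioms] .
      then have "R y \<in> fm.span (R ` ?M)"
        by (intro span_elementary_abelian_step[OF fin p less.prems(1) M _ _ _ less.prems(3)])
           (auto intro!: generate.incl)
      \<comment> \<open>Multiplication by \<open>R x\<close> is linear, so it is enough to treat
        \<open>R (x \<otimes> w)\<close> for single elements \<open>w\<close> of the smaller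
        subgroup, where the induction hypothesis applies.\<close>
      moreover have "fm.span (R ` ?M) \<subseteq> {b. mmul n (R x) b \<in> ?A}"
      proof (intro fm.span_minimal fmp.linear_subspace_linear_preimage[OF linear_mmul_left] fm.subspace_span)
        have "mmul n (R x) (R w) \<in> ?A" if "w \<in> ?M" for w
          using IH[OF BN BH Bconj less.prems(2) that] that generate_in_carrier[OF BG that] xG
          by (simp add: R_mult)
        then show "R ` ?M \<subseteq> {b. mmul n (R x) b \<in> ?A}" by blast
      qed
      ultimately have "mmul n (R x) (R y) \<in> ?A" by blast
      then show ?thesis using xG NG less.prems(3) by (simp add: R_mult)
    qed
  qed
qed

lemma p_regular_span:
  assumes fin: "finite (carrier G)" and p: "Factorial_Ring.prime p" "CHAR('k) = p" "\<not> p dvd n"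
    and ps: "p_solvable G p"
  shows "msquare n \<subseteq> fm.span (R ` p_regular G p)"
proof -
  obtain H m where ch: "p_chain G p H m" using p_solvable_imp_p_chain[OF fin p(1) ps] by blast
  have one: "\<one> \<in> p_regular G p" by (auto simp: p_regular_def intro!: exI[of _ 1])
  have "R y \<in> fm.span (R ` p_regular G p)" if "y \<in> carrier G" for y
    using normal_p_regular_span[OF fin p ch normal_self one that] that by simp
  then have "fm.span (R ` carrier G) \<subseteq> fm.span (R ` p_regular G p)"
    by (intro fm.span_minimal fm.subspace_span) blast
  then show ?thesis using spanning by blast
qed

end

section \<open>Burnside's theorem and semisimplicity\<close>

definition mat_fun :: "nat \<Rightarrow> 'a::field mat \<Rightarrow> nat \<Rightarrow> nat \<Rightarrow> 'a" where
  "mat_fun n A = (\<lambda>i j. if i < n \<and> j < n then A $$ (i, j) else 0)"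

lemma mat_fun_msquare: "mat_fun n A \<in> msquare n"
  by (simp add: mat_fun_def msquare_def)

lemma mat_fun_one: "mat_fun n (1\<^sub>m n) = mone n"
  by (auto simp: mat_fun_def mone_def fun_eq_iff)

lemma mat_fun_mult:
  assumes "A \<in> carrier_mat n n" "B \<in> carrier_mat n n"
  shows "mat_fun n (A * B) = mmul n (mat_fun n A) (mat_fun n B)"
  using assms by (auto simp: mat_fun_def mmul_def fun_eq_iff scalar_prod_def atLeast0LessThan)

lemma inj_on_mat_fun: "inj_on (mat_fun n) (carrier_mat n n)"
proof (rule inj_onI)
  fix A B :: "'a mat" assume AB: "A \<in> carrier_mat n n" "B \<in> carrier_mat n n" "mat_fun n A = mat_fun n B"
  have "A $$ (i, j) = B $$ (i, j)" if "i < n" "j < n" for i j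
    using fun_cong[OF fun_cong[OF AB(3), of i], of j] that by (simp add: mat_fun_def)
  then show "A = B" using AB by (intro eq_matI) auto
qed

lemma is_rep_imp_matrix_rep:
  assumes "group G" "is_rep G n \<rho>"
  shows "matrix_rep G n (\<lambda>g. mat_fun n (\<rho> g))"
  using assms
  by (simp add: matrix_rep_def matrix_rep_axioms_def is_rep_def mat_fun_msquare mat_fun_one mat_fun_mult)

text \<open>An eigenspace of \<open>Z\<close> is non-zero and invariant, hence everything; an
  eigenvalue exists because the field is algebraically closed and \<open>n\<close> is
  positive.\<close>

lemma schur_commutant:
  fixes \<rho> :: "'g \<Rightarrow> 'k::alg_closed_field mat"
  assumes rep: "is_rep G n \<rho>" and irr: "irreducible_rep G n \<rho>"
    and Z: "Z \<in> commutant n ((\<lambda>g. mat_fun n (\<rho> g)) ` carrier G)"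
  shows "\<exists>c. Z = mscale c (mone n)"
proof -
  define A where "A = mat n n (\<lambda>(i, j). Z i j)"
  have A: "A \<in> carrier_mat n n" by (simp add: A_def)
  have Zn: "Z \<in> msquare n" using Z by (simp add: commutant_def)
  have ZA: "mat_fun n A = Z"
    using msquare_eq_0[OF Zn] by (auto simp: mat_fun_def A_def fun_eq_iff)
  have n: "n > 0" using irr by (simp add: irreducible_rep_def)
  have \<rho>: "\<rho> g \<in> carrier_mat n n" if "g \<in> carrier G" for g using rep that by (simp add: is_rep_def)
  have comm: "A * \<rho> g = \<rho> g * A" if g: "g \<in> carrier G" for g
  proof (rule inj_onD[OF inj_on_mat_fun])
    show "mat_fun n (A * \<rho> g) = mat_fun n (\<rho> g * A)"
      using Z g by (simp add: mat_fun_mult[OF A \<rho>] mat_fun_mult[OF \<rho> A] ZA commutant_def)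
  qed (use A \<rho>[OF g] in auto)
  have "degree (char_poly A) > 0" using degree_monic_char_poly[OF A] n by simp
  then obtain c where "poly (char_poly A) c = 0" using alg_closed_imp_poly_has_root by blast
  then have "eigenvalue A c" using eigenvalue_root_char_poly[OF A] by simp
  then obtain v where v: "v \<in> carrier_vec n" "v \<noteq> 0\<^sub>v n" "A *\<^sub>v v = c \<cdot>\<^sub>v v"
    using A by (auto simp: eigenvalue_def eigenvector_def)
  let ?W = "{w \<in> carrier_vec n. A *\<^sub>v w = c \<cdot>\<^sub>v w}"
  have "subspace_vec n ?W"
    using A by (auto simp: subspace_vec_def mult_add_distrib_mat_vec smult_add_distrib_vec
        mult_mat_vec smult_smult_assoc mult.commute)
  moreover have "invariant_under (\<rho> g) ?W" if g: "g \<in> carrier G" for g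
    unfolding invariant_under_def
  proof
    fix w assume w: "w \<in> ?W"
    have "A *\<^sub>v (\<rho> g *\<^sub>v w) = (A * \<rho> g) *\<^sub>v w"
      using A \<rho>[OF g] w by (simp add: assoc_mult_mat_vec[of _ n n _ n])
    also have "\<dots> = \<rho> g *\<^sub>v (A *\<^sub>v w)"
      using A \<rho>[OF g] w by (simp add: comm[OF g] assoc_mult_mat_vec[of _ n n _ n])
    also have "\<dots> = c \<cdot>\<^sub>v (\<rho> g *\<^sub>v w)" using \<rho>[OF g] w by (simp add: mult_mat_vec)
    finally show "\<rho> g *\<^sub>v w \<in> ?W" using \<rho>[OF g] w by simp
  qed
  ultimately have "?W = carrier_vec n" using irr v unfolding irreducible_rep_def by blast
  then have "A *\<^sub>v unit_vec n j = c \<cdot>\<^sub>v unit_vec n j" for j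
    using unit_vec_carrier[of n j] by blast
  then have e: "(A *\<^sub>v unit_vec n j) $ i = (c \<cdot>\<^sub>v unit_vec n j) $ i" for i j by simp
  have "A $$ (i, j) = c * (if i = j then 1 else 0)" if "i < n" "j < n" for i j
    using e[of j i] that A by simp
  then have "Z = mscale c (mone n)"
    unfolding ZA[symmetric] by (auto simp: mat_fun_def mscale_def mone_def fun_eq_iff)
  then show ?thesis by blast
qed

text \<open>The matrices supported in column \<open>j\<close> are a copy of the representation
  space, with \<open>emb\<close> as isomorphism. This exhibits the matrix algebra as a sum of simple
  modules.\<close>

lemma irreducible_column_simple:
  fixes \<rho> :: "'g \<Rightarrow> 'k::field mat"
  assumes rep: "is_rep G n \<rho>" and irr: "irreducible_rep G n \<rho>" and j: "j < n"
  shows "fm.simple_stable (mmul n ` (\<lambda>g. mat_fun n (\<rho> g)) ` carrier G)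
    {A \<in> msquare n. \<forall>a b. b \<noteq> j \<longrightarrow> A a b = 0}"
    (is "fm.simple_stable ?T ?C")
proof -
  have \<rho>: "\<rho> g \<in> carrier_mat n n" if "g \<in> carrier G" for g using rep that by (simp add: is_rep_def)
  have "fm.subspace ?C"
    using subspace_msquare[of n] by (auto simp: fm.subspace_def mscale_def)
  moreover have "mmul n (mat_fun n (\<rho> g)) A \<in> ?C" if "A \<in> ?C" for g A
    using that mmul_msquare[OF mat_fun_msquare, of A n "\<rho> g"] by (auto simp: mmul_def)
  ultimately have C: "fm.stable ?T ?C" by (auto simp: fm.stable_def)
  define emb where "emb v = (\<lambda>a b. if b = j \<and> a < n then v $ a else 0)" for v :: "'k vec"
  have emb_add: "emb (v + w) = emb v + emb w" if "v \<in> carrier_vec n" "w \<in> carrier_vec n" for v w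
    using that by (auto simp: emb_def fun_eq_iff)
  have emb_smult: "emb (c \<cdot>\<^sub>v v) = mscale c (emb v)" if "v \<in> carrier_vec n" for v c
    using that by (auto simp: emb_def fun_eq_iff mscale_def)
  have emb_mult: "emb (\<rho> g *\<^sub>v v) = mmul n (mat_fun n (\<rho> g)) (emb v)"
    if "v \<in> carrier_vec n" "g \<in> carrier G" for v g
    using that \<rho>[OF that(2)] j
    by (auto simp: emb_def mat_fun_def mmul_def fun_eq_iff scalar_prod_def atLeast0LessThan)
  have emb_zero: "emb (0\<^sub>v n) = 0" by (auto simp: emb_def fun_eq_iff)
  have emb_vec: "emb (vec n (\<lambda>a. A a j)) = A" if "A \<in> ?C" for A
    using that msquare_eq_0[of A n] by (auto simp: emb_def fun_eq_iff)
  have "B = {0} \<or> B = ?C" if B: "fm.stable ?T B" "B \<subseteq> ?C" for B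
  proof -
    let ?W = "{v \<in> carrier_vec n. emb v \<in> B}"
    have Bsub: "fm.subspace B" using B(1) by (simp add: fm.stable_def)
    have "subspace_vec n ?W"
      unfolding subspace_vec_def
      using fm.subspace_0[OF Bsub] fm.subspace_add[OF Bsub] fm.subspace_scale[OF Bsub]
      by (auto simp: emb_add emb_smult emb_zero)
    moreover have "invariant_under (\<rho> g) ?W" if "g \<in> carrier G" for g
      using that \<rho>[OF that] B(1) by (auto simp: invariant_under_def emb_mult fm.stable_def)
    ultimately have W: "?W = {0\<^sub>v n} \<or> ?W = carrier_vec n"
      using irr unfolding irreducible_rep_def by blast
    have BW: "A \<in> B \<longleftrightarrow> vec n (\<lambda>a. A a j) \<in> ?W" if "A \<in> ?C" for A
      using emb_vec[OF that] by simp
    from W show ?thesis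
    proof
      assume W0: "?W = {0\<^sub>v n}"
      have "A = 0" if A: "A \<in> B" for A
      proof -
        have AC: "A \<in> ?C" using A B(2) by blast
        then have "vec n (\<lambda>a. A a j) = 0\<^sub>v n" using BW A W0 by blast
        then show ?thesis using emb_vec[OF AC] emb_zero by metis
      qed
      then show ?thesis using fm.subspace_0[OF Bsub] by blast
    next
      assume "?W = carrier_vec n"
      then have "A \<in> B" if "A \<in> ?C" for A using BW[OF that] by simp
      then show ?thesis using B(2) by blast
    qed
  qed
  then show ?thesis using C by (simp add: fm.simple_stable_def)
qed

text \<open>By Schur the commutant of the group consists of scalars, so every matrix centralises it
  and the double commutant theorem applies. The complement has to come from the simple columns,
  since \<open>clifford_complement\<close> presupposes the spanning property proved here.\<close>

lemma burnside:
  fixes \<rho> :: "'g \<Rightarrow> 'k::alg_closed_field mat"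
  assumes G: "group G" and rep: "is_rep G n \<rho>" and irr: "irreducible_rep G n \<rho>"
  shows "msquare n \<subseteq> fm.span ((\<lambda>g. mat_fun n (\<rho> g)) ` carrier G)"
proof
  fix C :: "nat \<Rightarrow> nat \<Rightarrow> 'k" assume C: "C \<in> msquare n"
  let ?R = "\<lambda>g. mat_fun n (\<rho> g)"
  let ?S = "?R ` carrier G"
  let ?T = "mmul n ` ?S"
  interpret matrix_rep G n ?R by (rule is_rep_imp_matrix_rep[OF G rep])
  let ?col = "\<lambda>j. {A \<in> msquare n. \<forall>a b. b \<noteq> j \<longrightarrow> A a b = (0 :: 'k)}"
  have S: "?S \<subseteq> msquare n" using mat_fun_msquare by blast
  have S1: "mone n \<in> ?S" using R_one by (metis image_eqI one_closed)
  have Smul: "mmul n s t \<in> ?S" if "s \<in> ?S" "t \<in> ?S" for s t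
    using that by (auto simp: R_mult[symmetric])
  have st: "fm.stable ?T (fm.span ?S)" by (rule stable_span[OF Smul])
  have "\<exists>U. fm.stable ?T U \<and> fm.span ?S \<inter> U = {0} \<and>
      fm.span (\<Union>(?col ` {..<n})) \<subseteq> {x + u |x u. x \<in> fm.span ?S \<and> u \<in> U}"
  proof (rule fm.stable_complement[OF _ _ st])
    show "t (x + y) = t x + t y" if "t \<in> ?T" for t x y
      using that by (auto simp: mmul_add_right)
    show "fm.simple_stable ?T B" if "B \<in> ?col ` {..<n}" for B
      using that irreducible_column_simple[OF rep irr] by auto
  qed
  then obtain U where U: "fm.stable ?T U" "fm.span ?S \<inter> U = {0}"
    "fm.span (\<Union>(?col ` {..<n})) \<subseteq> {x + u |x u. x \<in> fm.span ?S \<and> u \<in> U}" by blast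
  have "(\<lambda>(a, b). munit a b) ` ({..<n} \<times> {..<n}) \<subseteq> \<Union>(?col ` {..<n})"
    using munit_msquare by (auto simp: munit_def)
  then have "msquare n \<subseteq> fm.span (\<Union>(?col ` {..<n}))"
    using msquare_span_munit fm.span_mono by blast
  then have full: "msquare n \<subseteq> {x + u |x u. x \<in> fm.span ?S \<and> u \<in> U}" using U(3) by (rule subset_trans)
  show "C \<in> fm.span ?S"
  proof (rule double_commutant[OF S S1 Smul U(1,2) full C])
    fix A assume "A \<in> commutant n ?S"
    then obtain c where "A = mscale c (mone n)" using schur_commutant[OF rep irr] by blast
    then show "mmul n C A = mmul n A C"
      using C by (simp add: mmul_scale_left mmul_scale_right mmul_mone)
  qed
qed

text \<open>A \<open>k\<close>-linear retraction of the algebraic closure onto \<open>k\<close> turns a linear combination over the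
  closure into one over \<open>k\<close>.\<close>

lemma span_descent:
  fixes \<rho> :: "'g \<Rightarrow> 'k::field mat"
  assumes full: "msquare n \<subseteq> fm.span ((\<lambda>g. mat_fun n (map_mat to_ac (\<rho> g))) ` S)"
    and \<rho>: "\<And>g. g \<in> S \<Longrightarrow> \<rho> g \<in> carrier_mat n n"
  shows "msquare n \<subseteq> fm.span ((\<lambda>g. mat_fun n (\<rho> g)) ` S)"
proof
  fix A :: "nat \<Rightarrow> nat \<Rightarrow> 'k" assume A: "A \<in> msquare n"
  interpret kp: vector_space_pair "(*) :: 'k \<Rightarrow> 'k \<Rightarrow> 'k" "\<lambda>x c. to_ac x * c"
    by unfold_locales (auto simp: algebra_simps)
  have "Vector_Spaces.linear (*) (\<lambda>x c. to_ac x * c) (to_ac :: 'k \<Rightarrow> _)"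
    by (simp add: Vector_Spaces.linear_iff kp.vs1.vector_space_axioms kp.vs2.vector_space_axioms)
  then obtain \<pi> where \<pi>: "Vector_Spaces.linear (\<lambda>x c. to_ac x * c) ((*) :: 'k \<Rightarrow> 'k \<Rightarrow> 'k) \<pi>" "\<pi> \<circ> to_ac = id"
    using kp.linear_injective_left_inverse[OF _ inj_to_ac] by blast
  have \<pi>_id: "\<pi> (to_ac x) = x" for x using \<pi>(2) by (metis comp_apply id_apply)
  have \<pi>_add: "\<pi> (x + y) = \<pi> x + \<pi> y" and \<pi>_scale: "\<pi> (to_ac a * x) = a * \<pi> x" for x y a
    using \<pi>(1) by (simp_all add: Vector_Spaces.linear_iff)
  have \<pi>_0: "\<pi> 0 = 0" using \<pi>_id[of 0] by simp
  let ?A = "\<lambda>i j. to_ac (A i j)"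
  have "?A \<in> msquare n" using A by (simp add: msquare_def)
  then have "?A \<in> fm.span ((\<lambda>g. mat_fun n (map_mat to_ac (\<rho> g))) ` S)" using full by blast
  then have "(\<lambda>i j. \<pi> (?A i j)) \<in> fm.span ((\<lambda>g. mat_fun n (\<rho> g)) ` S)"
  proof (induction rule: fm.span_induct_alt)
    case base
    have "(\<lambda>i j. \<pi> ((0 :: nat \<Rightarrow> nat \<Rightarrow> 'k alg_closure) i j)) = 0" by (simp add: \<pi>_0 fun_eq_iff)
    then show ?case using fm.span_zero by metis
  next
    case (step c B C)
    then obtain g where g: "g \<in> S" "B = mat_fun n (map_mat to_ac (\<rho> g))" by blast
    \<comment> \<open>\<open>\<pi>\<close> need not be multiplicative, but the entries of the
      representing matrices lie in the image of \<open>to_ac\<close>, and such factors can be pulled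
      out of \<open>\<pi>\<close>.\<close>
    have "(\<lambda>i j. \<pi> ((mscale c B + C) i j)) = mscale (\<pi> c) (mat_fun n (\<rho> g)) + (\<lambda>i j. \<pi> (C i j))"
      using \<rho>[OF g(1)] \<pi>_scale
      by (auto simp: g(2) mscale_def mat_fun_def fun_eq_iff \<pi>_add \<pi>_0 mult.commute)
    moreover have "mscale (\<pi> c) (mat_fun n (\<rho> g)) + (\<lambda>i j. \<pi> (C i j)) \<in> fm.span ((\<lambda>g. mat_fun n (\<rho> g)) ` S)"
      by (rule fm.span_add[OF fm.span_scale[OF fm.span_base[OF imageI[OF g(1)]]] step(2)])
    ultimately show ?case by (simp only:)
  qed
  then show "A \<in> fm.span ((\<lambda>g. mat_fun n (\<rho> g)) ` S)" by (simp add: \<pi>_id)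
qed

section \<open>Semisimplicity of matrices of finite order prime to the characteristic\<close>

interpretation fv: operator_space "\<lambda>c v i. c * v i :: 'a::field"
  by unfold_locales (auto simp: fun_eq_iff algebra_simps)

lemma finite_order_imp_semisimple_mat:
  fixes A :: "'k::field mat"
  assumes A: "A \<in> carrier_mat n n" and r: "A ^\<^sub>m r = 1\<^sub>m n" "of_nat r \<noteq> (0 :: 'k)"
  shows "semisimple_mat n A"
  unfolding semisimple_mat_def
proof (intro allI impI)
  fix W assume W: "subspace_vec n W \<and> invariant_under A W"
  define f where "f v = (\<lambda>i. if i < n then v $ i else 0)" for v :: "'k vec"
  \<comment> \<open>\<open>T\<close> is multiplication by \<open>A\<close>, with value 0 from place
    \<open>n\<close> on; its \<open>r\<close>-th power is therefore the identity only on the image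
    of \<open>f\<close>, which serves as the subspace \<open>V\<close> of
    \<open>maschke_cyclic\<close>.\<close>
  define T where "T w = (\<lambda>i. if i < n then \<Sum>j<n. A $$ (i, j) * w j else 0)" for w
  have f_add: "f (v + w) = f v + f w" if "v \<in> carrier_vec n" "w \<in> carrier_vec n" for v w
    using that by (auto simp: f_def fun_eq_iff)
  have f_smult: "f (c \<cdot>\<^sub>v v) = (\<lambda>i. c * f v i)" if "v \<in> carrier_vec n" for c v
    using that by (auto simp: f_def fun_eq_iff)
  have f_zero: "f (0\<^sub>v n) = 0" by (auto simp: f_def fun_eq_iff)
  have f_inj: "v = w" if "v \<in> carrier_vec n" "w \<in> carrier_vec n" "f v = f w" for v w
  proof (rule eq_vecI)
    fix i assume "i < dim_vec w"
    then show "v $ i = w $ i" using fun_cong[OF that(3), of i] that(2) by (simp add: f_def)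
  qed (use that in auto)
  have fT: "T (f v) = f (A *\<^sub>v v)" if "v \<in> carrier_vec n" for v
    using that A by (auto simp: f_def T_def fun_eq_iff scalar_prod_def atLeast0LessThan)
  have fTk: "(T ^^ k) (f v) = f ((A ^\<^sub>m k) *\<^sub>v v)" if v: "v \<in> carrier_vec n" for k v
    using v
  proof (induction k arbitrary: v)
    case 0
    then show ?case using A by simp
  next
    case (Suc k)
    have "(T ^^ Suc k) (f v) = (T ^^ k) (f (A *\<^sub>v v))" using Suc.prems by (simp add: funpow_Suc_right fT del: funpow.simps)
    also have "\<dots> = f ((A ^\<^sub>m k) *\<^sub>v (A *\<^sub>v v))"
      by (rule Suc.IH) (use A Suc.prems in auto)
    also have "(A ^\<^sub>m k) *\<^sub>v (A *\<^sub>v v) = (A ^\<^sub>m Suc k) *\<^sub>v v"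
      using A Suc.prems by (simp add: assoc_mult_mat_vec[of _ n n _ n])
    finally show ?case .
  qed
  have sub: "fv.subspace (f ` X')" if X': "subspace_vec n X'" for X'
    unfolding fv.subspace_def
  proof (intro conjI ballI allI)
    have Xc: "X' \<subseteq> carrier_vec n" and X0: "0\<^sub>v n \<in> X'" using X' by (auto simp: subspace_vec_def)
    show "0 \<in> f ` X'" using X0 f_zero by (metis image_eqI)
    fix x assume "x \<in> f ` X'"
    then obtain v where v: "v \<in> X'" "x = f v" by blast
    show "(\<lambda>i. c * x i) \<in> f ` X'" for c
    proof (rule image_eqI)
      show "(\<lambda>i. c * x i) = f (c \<cdot>\<^sub>v v)" using v Xc f_smult by auto
      show "c \<cdot>\<^sub>v v \<in> X'" using v X' by (simp add: subspace_vec_def)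
    qed
    fix y assume "y \<in> f ` X'"
    then obtain w where w: "w \<in> X'" "y = f w" by blast
    show "x + y \<in> f ` X'"
    proof (rule image_eqI)
      show "x + y = f (v + w)" using v w Xc f_add by (metis subsetD)
      show "v + w \<in> X'" using v w X' by (simp add: subspace_vec_def)
    qed
  qed
  have Wc: "W \<subseteq> carrier_vec n" using W by (simp add: subspace_vec_def)
  have "\<exists>U. fv.subspace U \<and> U \<subseteq> f ` carrier_vec n \<and> (\<forall>u\<in>U. T u \<in> U) \<and> f ` W \<inter> U = {0} \<and>
     (\<forall>v\<in>f ` carrier_vec n. \<exists>w\<in>f ` W. \<exists>u\<in>U. v = w + u)"
  proof (rule fv.maschke_cyclic[OF _ _ _ _ r(2)])
    show "Vector_Spaces.linear (\<lambda>c v i. c * v i) (\<lambda>c v i. c * v i) T"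
      by (auto simp: Vector_Spaces.linear_iff fv.vector_space_axioms T_def fun_eq_iff
          sum.distrib sum_distrib_left algebra_simps)
    show "fv.subspace (f ` carrier_vec n)" by (rule sub) (auto simp: subspace_vec_def)
    show "T v \<in> f ` carrier_vec n" if "v \<in> f ` carrier_vec n" for v
      using that A by (auto simp: fT)
    show "(T ^^ r) v = v" if "v \<in> f ` carrier_vec n" for v
      using that by (auto simp: fTk r(1))
    show "fv.subspace (f ` W)" using W by (intro sub) simp
    show "f ` W \<subseteq> f ` carrier_vec n" using Wc by blast
    show "T v \<in> f ` W" if v: "v \<in> f ` W" for v
    proof -
      obtain w where w: "w \<in> W" "v = f w" using v by blast
      then have "T v = f (A *\<^sub>v w)" using fT Wc by blast
      moreover have "A *\<^sub>v w \<in> W" using W w by (simp add: invariant_under_def)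
      ultimately show ?thesis by blast
    qed
  qed
  then obtain U where U: "fv.subspace U" "U \<subseteq> f ` carrier_vec n" "\<And>u. u \<in> U \<Longrightarrow> T u \<in> U"
    "f ` W \<inter> U = {0}" "\<And>v. v \<in> f ` carrier_vec n \<Longrightarrow> \<exists>w\<in>f ` W. \<exists>u\<in>U. v = w + u"
    by metis
  let ?U = "{v \<in> carrier_vec n. f v \<in> U}"
  have W0: "0\<^sub>v n \<in> W" using W by (simp add: subspace_vec_def)
  have U0: "0\<^sub>v n \<in> ?U" using fv.subspace_0[OF U(1)] f_zero by simp
  have "subspace_vec n ?U"
    unfolding subspace_vec_def using U0 fv.subspace_add[OF U(1)] fv.subspace_scale[OF U(1)]
    by (auto simp: f_add f_smult)
  moreover have "invariant_under A ?U"
    unfolding invariant_under_def using U(3) A by (auto simp: fT[symmetric])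
  moreover have "W \<inter> ?U = {0\<^sub>v n}"
  proof -
    have "v = 0\<^sub>v n" if v: "v \<in> W" "v \<in> ?U" for v
    proof (rule f_inj)
      have "f v \<in> f ` W \<inter> U" using v by blast
      then show "f v = f (0\<^sub>v n)" unfolding U(4) f_zero by simp
    qed (use v in auto)
    then show ?thesis using W0 U0 by blast
  qed
  moreover have "\<exists>w\<in>W. \<exists>u\<in>?U. v = w + u" if v: "v \<in> carrier_vec n" for v
  proof -
    obtain w u where wu: "w \<in> W" "u \<in> U" "f v = f w + u" using U(5)[of "f v"] v by blast
    obtain u' where u': "u' \<in> carrier_vec n" "u = f u'" using U(2) wu(2) by blast
    have w: "w \<in> carrier_vec n" using wu(1) Wc by blast
    have "v = w + u'" using wu(3) u' w v by (intro f_inj) (auto simp: f_add)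
    then show ?thesis using wu u' by blast
  qed
  ultimately show "\<exists>U. subspace_vec n U \<and> invariant_under A U \<and> W \<inter> U = {0\<^sub>v n} \<and>
       (\<forall>v\<in>carrier_vec n. \<exists>w\<in>W. \<exists>u\<in>U. v = w + u)"
    by (intro exI[of _ ?U]) blast
qed

lemma is_rep_pow:
  assumes G: "group G" and rep: "is_rep G n \<rho>" and x: "x \<in> carrier G"
  shows "\<rho> (x [^]\<^bsub>G\<^esub> (k :: nat)) = \<rho> x ^\<^sub>m k"
proof (induction k)
  case 0
  have "\<rho> x \<in> carrier_mat n n" using rep x by (simp add: is_rep_def)
  then show ?case using rep by (simp add: is_rep_def)
next
  case (Suc k)
  then show ?case
    using rep x monoid.nat_pow_closed[OF group.is_monoid[OF G] x] by (simp add: is_rep_def)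
qed

lemma p_regular_semisimple:
  fixes \<rho> :: "'g \<Rightarrow> 'k::field mat"
  assumes p: "Factorial_Ring.prime p" "CHAR('k) = p" and G: "group G" and rep: "is_rep G n \<rho>"
    and x: "x \<in> p_regular G p"
  shows "semisimple_mat n (\<rho> x)"
proof -
  obtain r where r: "coprime r p" "x [^]\<^bsub>G\<^esub> r = \<one>\<^bsub>G\<^esub>" and xG: "x \<in> carrier G"
    using x by (auto simp: p_regular_def)
  have "\<not> p dvd r"
    using coprime_common_divisor[OF r(1), of p] p(1) by auto
  then have "of_nat r \<noteq> (0 :: 'k)" using p(2) by (simp add: of_nat_eq_0_iff_char_dvd)
  moreover have "\<rho> x ^\<^sub>m r = 1\<^sub>m n"
    using is_rep_pow[OF G rep xG, of r] r(2) rep by (simp add: is_rep_def)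
  ultimately show ?thesis
    using rep xG by (intro finite_order_imp_semisimple_mat) (auto simp: is_rep_def)
qed

theorem theorem1p2:
  fixes G :: "('g, 'b) monoid_scheme" and p n :: nat and \<rho> :: "'g \<Rightarrow> 'k::field mat"
  assumes "Factorial_Ring.prime p"
    and "group G" and "finite (carrier G)" and "p_solvable G p"
    and "CHAR('k) = p"
    and "is_rep G n \<rho>"
    and "abs_irreducible_rep G n \<rho>"
    and "\<not> p dvd n"
  shows "weakly_adequate G n \<rho>"
proof -
  let ?\<rho> = "\<lambda>g. map_mat to_ac (\<rho> g)"
  let ?R = "\<lambda>g. mat_fun n (\<rho> g)"
  have \<rho>: "\<rho> g \<in> carrier_mat n n" if "g \<in> carrier G" for g
    using assms(6) that by (simp add: is_rep_def)
  interpret ac: inj_semiring_hom "to_ac :: 'k \<Rightarrow> _" by unfold_locales auto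
  have irr: "irreducible_rep G n ?\<rho>" using assms(7) by (simp add: abs_irreducible_rep_def)
  have "is_rep G n ?\<rho>"
    using assms(6) by (auto simp: is_rep_def ac.mat_hom_one ac.mat_hom_mult[of _ n n _ n])
  then have "msquare n \<subseteq> fm.span ((\<lambda>g. mat_fun n (?\<rho> g)) ` carrier G)"
    using irr by (rule burnside[OF assms(2)])
  then have "msquare n \<subseteq> fm.span (?R ` carrier G)" using \<rho> by (rule span_descent)
  moreover have "0 < n" using irr by (simp add: irreducible_rep_def)
  ultimately interpret spanning_matrix_rep G n ?R
    using is_rep_imp_matrix_rep[OF assms(2,6)]
    by (simp add: spanning_matrix_rep_def spanning_matrix_rep_axioms_def)
  have span: "msquare n \<subseteq> fm.span (?R ` p_regular G p)"
    by (rule p_regular_span[OF assms(3,1,5,8,4)])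
  let ?F = "\<rho> ` p_regular G p"
  have sub: "p_regular G p \<subseteq> carrier G" by (auto simp: p_regular_def)
  have finF: "finite ?F" using finite_subset[OF sub assms(3)] by simp
  have FC: "?F \<subseteq> carrier_mat n n" using sub \<rho> by blast
  have FS: "?F \<subseteq> {\<rho> g | g. g \<in> carrier G \<and> semisimple_mat n (\<rho> g)}"
    using sub p_regular_semisimple[OF assms(1,5,2,6)] by blast
  have "\<exists>c. \<forall>i<n. \<forall>j<n. M $$ (i, j) = (\<Sum>A\<in>?F. c A * A $$ (i, j))" for M
  proof -
    have "mat_fun n M \<in> fm.span (mat_fun n ` ?F)"
      using span mat_fun_msquare[of n M] by (simp add: image_image subset_iff)
    then obtain u where "mat_fun n M = (\<Sum>v\<in>mat_fun n ` ?F. mscale (u v) v)"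
      using fm.span_finite[of "mat_fun n ` ?F"] finF by auto
    \<comment> \<open>The span provides coefficients indexed by functions; injectivity of
      \<open>mat_fun\<close> on square matrices re-indexes the sum by the matrices themselves
      without merging terms.\<close>
    also have "\<dots> = (\<Sum>A\<in>?F. mscale (u (mat_fun n A)) (mat_fun n A))"
      using inj_on_subset[OF inj_on_mat_fun FC] by (simp add: sum.reindex)
    finally have eq: "mat_fun n M = (\<Sum>A\<in>?F. mscale (u (mat_fun n A)) (mat_fun n A))" .
    have "M $$ (i, j) = (\<Sum>A\<in>?F. u (mat_fun n A) * A $$ (i, j))" if "i < n" "j < n" for i j
      using fun_cong[OF fun_cong[OF eq, of i], of j] that
      by (simp add: sum_fun_apply mscale_def mat_fun_def)
    then show ?thesis by (intro exI[of _ "\<lambda>A. u (mat_fun n A)"]) simp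
  qed
  then show ?thesis
    unfolding weakly_adequate_def
    by (intro ballI exI[of _ ?F]) (simp only: finF FS simp_thms ex_simps)
qed

end
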